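(* Assume the linear model $Y_i=\beta^TX_i+\epsilon_i$, $i=1,\dots,n$, described in the context, with $X_i\overset{i.i.d.}{\sim}N(\mathbf{0},\mathbf{I})$ and $\epsilon_1,\dots,\epsilon_n\sim N(0,\sigma^2)$. When $\tau^2+\sigma^2$ is bounded and $p/n$ converges to a constant, $$\sqrt n\left(\hat\tau^2-\hat\tau^2_{Dicker}\right)\overset{p}{\rightarrow}0 .$$
   Context: Setting. $(X_1,Y_1),\dots,(X_n,Y_n)$ are i.i.d. with $X_i\in\mathbb{R}^p$, $Y_i=\beta^TX_i+\epsilon_i$, $E(\epsilon_i|X_i)=0$, $E(\epsilon_i^2|X_i)=\sigma^2$, $E(X_i)=0$, $\mathrm{Cov}(X_i)=\mathbf{I}$. The signal level is $\tau^2=\|\beta\|^2$. Limits are taken as $n$ and $p=p_n$ go together to $\infty$; $\beta,\sigma^2$ may vary with $n$. With $W_{ij}=X_{ij}Y_i$ and $W_i=(W_{i1},\dots,W_{ip})^T$, the naive estimator is $\hat\tau^2=\binom n2^{-1}\sum_{i_1<i_2}W_{i_1}^TW_{i_2}$. With $\mathbf{X}$ the $n\times p$ design matrix (rows $X_i^T$) and $\mathbf{Y}=(Y_1,\dots,Y_n)^T$, $$\hat\tau^2_{Dicker}=\frac{\|\mathbf{X}^T\mathbf{Y}\|^2-p\|\mathbf{Y}\|^2}{n(n+1)} .$$ *)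

theory Defs
  imports "HOL-Probability.Probability"
begin

text \<open>
  The dimension \<open>p\<close> varies with \<open>n\<close>, so a vector in \<open>\<real>\<^sup>p\<close> is a function on the index set
  \<open>{..<p}\<close>, and indices run from \<open>0\<close>. Deterministic vectors such as \<open>\<beta>\<close> are plain functions of
  which only the values on \<open>{..<p}\<close> are used; a random vector takes values in the product space
  below, whose points are \<open>undefined\<close> outside \<open>{..<p}\<close>.
\<close>

abbreviation vec_borel :: "nat \<Rightarrow> (nat \<Rightarrow> real) measure" where
  "vec_borel p \<equiv> PiM {..<p} (\<lambda>_. borel)"

definition std_normal_vec :: "nat \<Rightarrow> (nat \<Rightarrow> real) measure" where
  "std_normal_vec p = PiM {..<p} (\<lambda>_. density lborel (\<lambda>x. ennreal (std_normal_density x)))"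

text \<open>
  The normal law with mean \<open>m\<close> and variance \<open>v\<close>. The case \<open>v = 0\<close> is separate because
  \<open>normal_density m 0\<close> is identically zero, while the degenerate normal law is a point mass.
\<close>

definition normal_law :: "real \<Rightarrow> real \<Rightarrow> real measure" where
  "normal_law m v =
     (if v = 0 then return borel m
      else density lborel (\<lambda>x. ennreal (normal_density m (sqrt v) x)))"

text \<open>
  Conditional expectations given \<open>X i\<close> are taken with respect to the sigma-algebra generated by
  \<open>X i\<close>. The noise is not assumed to be independent of the covariates.
\<close>

locale linear_model = prob_space M
  for M :: "'a measure" +
  fixes n p :: nat
    and X :: "nat \<Rightarrow> 'a \<Rightarrow> nat \<Rightarrow> real"
    and Y \<epsilon> :: "nat \<Rightarrow> 'a \<Rightarrow> real"
    and \<beta> :: "nat \<Rightarrow> real"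
    and \<sigma>2 :: real
  assumes independent:
      "indep_vars (\<lambda>_. vec_borel p \<Otimes>\<^sub>M borel) (\<lambda>i \<omega>. (X i \<omega>, Y i \<omega>)) {..<n}"
    and identically_distributed:
      "\<And>i k. i < n \<Longrightarrow> k < n \<Longrightarrow>
         distr M (vec_borel p \<Otimes>\<^sub>M borel) (\<lambda>\<omega>. (X i \<omega>, Y i \<omega>)) =
         distr M (vec_borel p \<Otimes>\<^sub>M borel) (\<lambda>\<omega>. (X k \<omega>, Y k \<omega>))"
    and linear:
      "\<And>i \<omega>. i < n \<Longrightarrow> \<omega> \<in> space M \<Longrightarrow> Y i \<omega> = (\<Sum>j<p. \<beta> j * X i \<omega> j) + \<epsilon> i \<omega>"
    and noise_integrable: "\<And>i. i < n \<Longrightarrow> integrable M (\<epsilon> i)"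
    and noise_sq_integrable: "\<And>i. i < n \<Longrightarrow> integrable M (\<lambda>\<omega>. (\<epsilon> i \<omega>)\<^sup>2)"
    and noise_cond_mean:
      "\<And>i. i < n \<Longrightarrow> AE \<omega> in M.
         real_cond_exp M (vimage_algebra (space M) (X i) (vec_borel p)) (\<epsilon> i) \<omega> = 0"
    and noise_cond_var:
      "\<And>i. i < n \<Longrightarrow> AE \<omega> in M.
         real_cond_exp M (vimage_algebra (space M) (X i) (vec_borel p)) (\<lambda>\<omega>. (\<epsilon> i \<omega>)\<^sup>2) \<omega> = \<sigma>2"
    and noise_var_nonneg: "0 \<le> \<sigma>2"
    and covariate_sq_integrable:
      "\<And>i j. i < n \<Longrightarrow> j < p \<Longrightarrow> integrable M (\<lambda>\<omega>. (X i \<omega> j)\<^sup>2)"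
    and covariate_mean: "\<And>i j. i < n \<Longrightarrow> j < p \<Longrightarrow> expectation (\<lambda>\<omega>. X i \<omega> j) = 0"
    and covariate_cov:
      "\<And>i j k. i < n \<Longrightarrow> j < p \<Longrightarrow> k < p \<Longrightarrow>
         expectation (\<lambda>\<omega>. (X i \<omega> j - expectation (\<lambda>\<omega>. X i \<omega> j)) *
                          (X i \<omega> k - expectation (\<lambda>\<omega>. X i \<omega> k))) = (if j = k then 1 else 0)"

definition signal_level :: "nat \<Rightarrow> (nat \<Rightarrow> real) \<Rightarrow> real" where
  "signal_level p \<beta> = (\<Sum>j<p. (\<beta> j)\<^sup>2)"

text \<open>
  The estimators are functions of a realized sample: \<open>x i j\<close> is the \<open>(i, j)\<close> entry of the design
  matrix and \<open>y i\<close> the \<open>i\<close>-th response.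
\<close>

definition W :: "(nat \<Rightarrow> nat \<Rightarrow> real) \<Rightarrow> (nat \<Rightarrow> real) \<Rightarrow> nat \<Rightarrow> nat \<Rightarrow> real" where
  "W x y i j = x i j * y i"

definition naive_estimator ::
    "nat \<Rightarrow> nat \<Rightarrow> (nat \<Rightarrow> nat \<Rightarrow> real) \<Rightarrow> (nat \<Rightarrow> real) \<Rightarrow> real" where
  "naive_estimator n p x y =
     inverse (real (n choose 2)) *
     (\<Sum>(i1, i2) \<in> {(i1, i2). i1 < i2 \<and> i2 < n}. \<Sum>j<p. W x y i1 j * W x y i2 j)"

definition dicker_estimator ::
    "nat \<Rightarrow> nat \<Rightarrow> (nat \<Rightarrow> nat \<Rightarrow> real) \<Rightarrow> (nat \<Rightarrow> real) \<Rightarrow> real" where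
  "dicker_estimator n p x y =
     ((\<Sum>j<p. (\<Sum>i<n. x i j * y i)\<^sup>2) - real p * (\<Sum>i<n. (y i)\<^sup>2)) / (real n * (real n + 1))"

text \<open>
  Convergence in probability to a constant; the \<open>n\<close>-th variable may live on its own space.
\<close>

definition converges_in_probability ::
    "(nat \<Rightarrow> 'a measure) \<Rightarrow> (nat \<Rightarrow> 'a \<Rightarrow> real) \<Rightarrow> real \<Rightarrow> bool" where
  "converges_in_probability M Z c \<longleftrightarrow>
     (\<forall>e>0. (\<lambda>n. measure (M n) {\<omega> \<in> space (M n). \<bar>Z n \<omega> - c\<bar> > e}) \<longlonglongrightarrow> 0)"

end

theory Submission
  imports Defs "HOL-Real_Asymp.Real_Asymp"
begin

text \<open>
  Write \<open>\<tau>\<^sup>2\<close> for the signal level and \<open>D\<^sub>i = (\<parallel>X\<^sub>i\<parallel>\<^sup>2 - p) Y\<^sub>i\<^sup>2\<close>. Both estimators are built from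
  \<open>Q = \<parallel>\<Sum>\<^sub>i W\<^sub>i\<parallel>\<^sup>2 = \<parallel>\<^bold>X\<^sup>T \<^bold>Y\<parallel>\<^sup>2\<close> and its diagonal part \<open>V = \<Sum>\<^sub>i \<parallel>W\<^sub>i\<parallel>\<^sup>2\<close>: the naive estimator is
  \<open>(Q - V) / (n (n - 1))\<close>, while the other one is \<open>(Q - V + \<Sum>\<^sub>i D\<^sub>i) / (n (n + 1))\<close>. Hence their
  difference is exactly
    \<open>(2 (Q - V) / (n (n - 1)) - (1/n) \<Sum>\<^sub>i D\<^sub>i) / (n + 1)\<close>   (\<open>estimator_difference\<close>).
  It is enough that the numerator is bounded in \<open>L\<^sup>1\<close>: the difference is then \<open>O(1/n)\<close> in \<open>L\<^sup>1\<close>,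
  and Markov's inequality absorbs the factor \<open>sqrt n\<close>.

  The first term is easy because \<open>\<bar>Q - V\<bar> \<le> Q + V\<close>, whose mean is computed exactly: \<open>E Q\<close> follows
  from independence over \<open>i\<close> and \<open>E W\<^sub>i\<^sub>j = \<beta>\<^sub>j\<close>, and it is of order \<open>n p + n\<^sup>2\<close>
  (\<open>expectation_cross_terms\<close>).

  The second term is delicate, since \<open>D\<^sub>i\<close> has size \<open>sqrt p\<close> and a bound on \<open>E \<bar>D\<^sub>i\<bar>\<close> would not do.
  Its mean, however, is only \<open>2 \<tau>\<^sup>2\<close>: conditionally on \<open>X\<^sub>i\<close> the noise contributes the constant
  \<open>\<sigma>\<^sup>2\<close> to the mean of \<open>Y\<^sub>i\<^sup>2\<close>, which is cancelled by the centering of \<open>\<parallel>X\<^sub>i\<parallel>\<^sup>2\<close>, and Gaussian moments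
  give \<open>E ((\<parallel>X\<^sub>i\<parallel>\<^sup>2 - p) (\<beta>\<^sup>T X\<^sub>i)\<^sup>2) = 2 \<tau>\<^sup>2\<close> (\<open>mean_excess_response\<close>). The fluctuation of the average
  around this mean has variance at most \<open>E D\<^sub>i\<^sup>2 / n\<close>, which is of order \<open>p / n\<close>, so bounded. The noise
  may depend on the covariates beyond its first two conditional moments, so the bound on \<open>E D\<^sub>i\<^sup>2\<close>
  separates \<open>X\<^sub>i\<close> and \<open>Y\<^sub>i\<close> by the inequality of arithmetic and geometric means and uses
  \<open>E (\<parallel>X\<^sub>i\<parallel>\<^sup>2 - p)\<^sup>4 = 12 p\<^sup>2 + 48 p\<close> and the eighth moments of the marginal normal laws of
  \<open>\<beta>\<^sup>T X\<^sub>i\<close> and \<open>\<epsilon>\<^sub>i\<close> (\<open>second_moment_excess_response\<close>).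
\<close>

section \<open>Algebraic comparison of the two estimators\<close>

definition norm_excess :: "nat \<Rightarrow> (nat \<Rightarrow> real) \<Rightarrow> real" where
  "norm_excess m z = (\<Sum>j<m. (z j)\<^sup>2 - 1)"

lemma square_sum_eq_pairs:
  fixes a :: "nat \<Rightarrow> real"
  shows "(\<Sum>i<n. a i)\<^sup>2 =
    (\<Sum>i<n. (a i)\<^sup>2) + 2 * (\<Sum>(i1, i2) \<in> {(i1, i2). i1 < i2 \<and> i2 < n}. a i1 * a i2)"
proof (induction n)
  case (Suc n)
  have split: "{(i1, i2). i1 < i2 \<and> i2 < Suc n} =
      {(i1, i2). i1 < i2 \<and> i2 < n} \<union> (\<lambda>i. (i, n)) ` {..<n}"
    by (auto simp: less_Suc_eq)
  have fin: "finite {(i1, i2). i1 < i2 \<and> i2 < n}"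
    by (rule finite_subset[of _ "{..<n} \<times> {..<n}"]) auto
  have "(\<Sum>(i1, i2) \<in> {(i1, i2). i1 < i2 \<and> i2 < Suc n}. a i1 * a i2) =
      (\<Sum>(i1, i2) \<in> {(i1, i2). i1 < i2 \<and> i2 < n}. a i1 * a i2) +
      (\<Sum>(i1, i2) \<in> (\<lambda>i. (i, n)) ` {..<n}. a i1 * a i2)"
    unfolding split by (rule sum.union_disjoint) (use fin in auto)
  also have "(\<Sum>(i1, i2) \<in> (\<lambda>i. (i, n)) ` {..<n}. a i1 * a i2) = (\<Sum>i<n. a i) * a n"
    by (subst sum.reindex) (auto simp: inj_on_def sum_distrib_right)
  finally show ?case using Suc.IH
    by (simp add: power2_eq_square algebra_simps)
qed simp

text \<open>
  The leading terms of the two estimators cancel up to the relative factor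
  \<open>1/(n - 1) - 1/(n + 1) = 2/((n - 1)(n + 1))\<close>; this is what gains a power of \<open>n\<close>. What remains is
  the diagonal \<open>\<Sum>\<^sub>i \<parallel>W\<^sub>i\<parallel>\<^sup>2\<close>, centered by \<open>p \<parallel>Y\<parallel>\<^sup>2\<close>.
\<close>

lemma estimator_difference:
  fixes x :: "nat \<Rightarrow> nat \<Rightarrow> real" and y :: "nat \<Rightarrow> real"
  assumes n: "2 \<le> n"
  shows "naive_estimator n p x y - dicker_estimator n p x y =
    (2 * ((\<Sum>j<p. (\<Sum>i<n. x i j * y i)\<^sup>2) - (\<Sum>i<n. \<Sum>j<p. (x i j * y i)\<^sup>2)) / (real n * (real n - 1))
      - (\<Sum>i<n. norm_excess p (x i) * (y i)\<^sup>2) / real n) / (real n + 1)"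
proof -
  define P where "P = (\<Sum>(i1, i2) \<in> {(i1, i2). i1 < i2 \<and> i2 < n}. \<Sum>j<p. W x y i1 j * W x y i2 j)"
  define Q where "Q = (\<Sum>j<p. (\<Sum>i<n. x i j * y i)\<^sup>2)"
  define V where "V = (\<Sum>i<n. \<Sum>j<p. (x i j * y i)\<^sup>2)"
  define s where "s = (\<Sum>i<n. (y i)\<^sup>2)"
  have QV: "Q = V + 2 * P"
  proof -
    have "Q = (\<Sum>j<p. (\<Sum>i<n. (x i j * y i)\<^sup>2)
        + 2 * (\<Sum>(i1, i2) \<in> {(i1, i2). i1 < i2 \<and> i2 < n}. (x i1 j * y i1) * (x i2 j * y i2)))"
      unfolding Q_def by (simp only: square_sum_eq_pairs)
    also have "\<dots> = V + 2 * P"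
      unfolding V_def P_def W_def
      by (simp add: sum.distrib sum_distrib_left[symmetric] sum.swap[of _ "{..<p}"] case_prod_unfold)
    finally show ?thesis .
  qed
  have D: "(\<Sum>i<n. norm_excess p (x i) * (y i)\<^sup>2) = V - real p * s"
    by (simp add: norm_excess_def V_def s_def sum_subtractf left_diff_distrib sum_distrib_left sum_distrib_right power_mult_distrib)
  have naive: "naive_estimator n p x y = 2 * P / (real n * (real n - 1))"
  proof -
    have "real (n choose 2) = real n * (real n - 1) / 2"
    proof -
      have "real (n choose 2) = real (n * (n - 1)) / real 2"
        unfolding choose_two by (rule real_of_nat_div) (cases n; simp)
      then show ?thesis using n by (simp add: of_nat_diff)
    qed
    then show ?thesis unfolding naive_estimator_def P_def[symmetric] by (simp only: inverse_divide) simp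
  qed
  have dicker: "dicker_estimator n p x y = (Q - real p * s) / (real n * (real n + 1))"
    by (simp add: dicker_estimator_def Q_def s_def)
  have nz: "real n \<noteq> 0" "real n - 1 \<noteq> 0" "real n + 1 \<noteq> 0" using n by auto
  have "2 * P / (N * (N - 1)) - (V + 2 * P - r) / (N * (N + 1)) =
    (2 * (V + 2 * P - V) / (N * (N - 1)) - (V - r) / N) / (N + 1)"
    if "N \<noteq> 0" "N - 1 \<noteq> 0" "N + 1 \<noteq> 0" for N r :: real
    using that by (simp add: divide_simps) algebra
  from this[OF nz, of "real p * s"]
  show ?thesis
    unfolding naive dicker D Q_def[symmetric] V_def[symmetric] QV .
qed

section \<open>Random variables with finite moments\<close>

context prob_space
begin

text \<open>
  All random variables below are polynomials in normal variables. Since this class is closed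
  under polynomial operations, integrability can be read off the shape of the integrand, whatever
  the dependence between the variables involved.
\<close>

definition finite_moments :: "('a \<Rightarrow> real) \<Rightarrow> bool" where
  "finite_moments f \<longleftrightarrow> f \<in> borel_measurable M \<and> (\<forall>k. integrable M (\<lambda>\<omega>. \<bar>f \<omega>\<bar> ^ k))"

lemma finite_momentsD:
  assumes "finite_moments f"
  shows "f \<in> borel_measurable M" "integrable M (\<lambda>\<omega>. f \<omega> ^ k)" "integrable M f"
proof -
  show meas: "f \<in> borel_measurable M" using assms by (simp add: finite_moments_def)
  have *: "integrable M (\<lambda>\<omega>. f \<omega> ^ k)" for k
  proof (rule Bochner_Integration.integrable_bound)
    show "integrable M (\<lambda>\<omega>. \<bar>f \<omega>\<bar> ^ k)" using assms by (simp add: finite_moments_def)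
  qed (use meas in \<open>auto simp: power_abs\<close>)
  show "integrable M (\<lambda>\<omega>. f \<omega> ^ k)" by (rule *)
  show "integrable M f" using *[of 1] by simp
qed

lemma finite_moments_cong:
  assumes "finite_moments f" and "\<And>\<omega>. \<omega> \<in> space M \<Longrightarrow> f \<omega> = g \<omega>"
  shows "finite_moments g"
  using assms unfolding finite_moments_def
  by (simp cong: measurable_cong Bochner_Integration.integrable_cong)

lemma finite_moments_const: "finite_moments (\<lambda>_. c)"
  by (simp add: finite_moments_def)

lemma finite_moments_add:
  assumes f: "finite_moments f" and g: "finite_moments g"
  shows "finite_moments (\<lambda>\<omega>. f \<omega> + g \<omega>)"
proof -
  note [measurable] = finite_momentsD(1)[OF f] finite_momentsD(1)[OF g]
  have bound: "\<bar>a + b\<bar> ^ k \<le> 2 ^ k * (\<bar>a\<bar> ^ k + \<bar>b\<bar> ^ k)" for a b :: real and k :: nat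
  proof -
    have "\<bar>a + b\<bar> ^ k \<le> (2 * max \<bar>a\<bar> \<bar>b\<bar>) ^ k"
      by (intro power_mono) auto
    also have "\<dots> \<le> 2 ^ k * (\<bar>a\<bar> ^ k + \<bar>b\<bar> ^ k)"
      by (simp add: power_mult_distrib max_def)
    finally show ?thesis .
  qed
  have "integrable M (\<lambda>\<omega>. \<bar>f \<omega> + g \<omega>\<bar> ^ k)" for k
  proof (rule Bochner_Integration.integrable_bound)
    show "integrable M (\<lambda>\<omega>. 2 ^ k * (\<bar>f \<omega>\<bar> ^ k + \<bar>g \<omega>\<bar> ^ k))"
      using f g by (simp add: finite_moments_def)
    show "AE \<omega> in M. norm (\<bar>f \<omega> + g \<omega>\<bar> ^ k) \<le> norm (2 ^ k * (\<bar>f \<omega>\<bar> ^ k + \<bar>g \<omega>\<bar> ^ k))"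
    proof (rule AE_I2)
      fix \<omega>
      have "norm (\<bar>f \<omega> + g \<omega>\<bar> ^ k) = \<bar>f \<omega> + g \<omega>\<bar> ^ k" by simp
      also note bound[of "f \<omega>" "g \<omega>" k]
      finally show "norm (\<bar>f \<omega> + g \<omega>\<bar> ^ k) \<le> norm (2 ^ k * (\<bar>f \<omega>\<bar> ^ k + \<bar>g \<omega>\<bar> ^ k))"
        by (simp only: real_norm_def)
    qed
  qed measurable
  then show ?thesis by (simp add: finite_moments_def)
qed

lemma finite_moments_mult:
  assumes f: "finite_moments f" and g: "finite_moments g"
  shows "finite_moments (\<lambda>\<omega>. f \<omega> * g \<omega>)"
proof -
  note [measurable] = finite_momentsD(1)[OF f] finite_momentsD(1)[OF g]
  have "integrable M (\<lambda>\<omega>. \<bar>f \<omega> * g \<omega>\<bar> ^ k)" for k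
  proof (rule Bochner_Integration.integrable_bound)
    show "integrable M (\<lambda>\<omega>. \<bar>f \<omega>\<bar> ^ (k * 2) + \<bar>g \<omega>\<bar> ^ (k * 2))"
      using f g by (simp add: finite_moments_def)
    show "AE \<omega> in M. norm (\<bar>f \<omega> * g \<omega>\<bar> ^ k) \<le> norm (\<bar>f \<omega>\<bar> ^ (k * 2) + \<bar>g \<omega>\<bar> ^ (k * 2))"
    proof (rule AE_I2)
      fix \<omega>
      have "2 * (\<bar>f \<omega>\<bar> ^ k * \<bar>g \<omega>\<bar> ^ k) \<le> (\<bar>f \<omega>\<bar> ^ k)\<^sup>2 + (\<bar>g \<omega>\<bar> ^ k)\<^sup>2"
        using sum_squares_bound[of "\<bar>f \<omega>\<bar> ^ k" "\<bar>g \<omega>\<bar> ^ k"] by simp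
      moreover have "0 \<le> \<bar>f \<omega>\<bar> ^ k * \<bar>g \<omega>\<bar> ^ k" by simp
      ultimately show "norm (\<bar>f \<omega> * g \<omega>\<bar> ^ k) \<le> norm (\<bar>f \<omega>\<bar> ^ (k * 2) + \<bar>g \<omega>\<bar> ^ (k * 2))"
        unfolding power_mult abs_mult power_mult_distrib real_norm_def by linarith
    qed
  qed measurable
  then show ?thesis by (simp add: finite_moments_def)
qed

lemma finite_moments_diff:
  assumes "finite_moments f" "finite_moments g"
  shows "finite_moments (\<lambda>\<omega>. f \<omega> - g \<omega>)"
  using finite_moments_add[OF assms(1) finite_moments_mult[OF finite_moments_const[of "-1"] assms(2)]]
  by simp

lemma finite_moments_power:
  "finite_moments f \<Longrightarrow> finite_moments (\<lambda>\<omega>. f \<omega> ^ k)"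
  by (induction k) (auto intro: finite_moments_const finite_moments_mult)

lemma finite_moments_sum:
  "(\<And>i. i \<in> I \<Longrightarrow> finite_moments (f i)) \<Longrightarrow> finite_moments (\<lambda>\<omega>. \<Sum>i\<in>I. f i \<omega>)"
  by (induction I rule: infinite_finite_induct) (auto intro: finite_moments_const finite_moments_add)

lemmas finite_moments_intros =
  finite_moments_const finite_moments_add finite_moments_diff finite_moments_mult
  finite_moments_power finite_moments_sum

text \<open>
  Both means and variances of sums over the sample come from this identity: the common mean is
  \<open>\<beta>\<^sub>j\<close> for the summands \<open>W\<^sub>i\<^sub>j\<close>, and \<open>0\<close> for centered summands.
\<close>

lemma expectation_square_sum_indep:
  assumes indep: "indep_vars (\<lambda>_. borel) V {..<n}"
    and mom: "\<And>i. i < n \<Longrightarrow> finite_moments (V i)"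
    and mean: "\<And>i. i < n \<Longrightarrow> expectation (V i) = m"
  shows "expectation (\<lambda>\<omega>. (\<Sum>i<n. V i \<omega>)\<^sup>2) =
    (\<Sum>i<n. expectation (\<lambda>\<omega>. (V i \<omega>)\<^sup>2)) + real n * (real n - 1) * m\<^sup>2"
proof -
  have cross: "expectation (\<lambda>\<omega>. V i \<omega> * V k \<omega>) = (if i = k then expectation (\<lambda>\<omega>. (V i \<omega>)\<^sup>2) - m\<^sup>2 else 0) + m\<^sup>2"
    if i: "i < n" and k: "k < n" for i k
  proof (cases "i = k")
    case False
    have "indep_vars (\<lambda>_. borel) V (insert i {k})"
      by (rule indep_vars_subset[OF indep]) (use i k in auto)
    then have "indep_var borel (V i) borel (V k)"
      using indep_vars_sum[of "{k}" i V] False by simp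
    then have "expectation (\<lambda>\<omega>. V i \<omega> * V k \<omega>) = expectation (V i) * expectation (V k)"
      by (rule indep_var_lebesgue_integral) (use mom i k finite_momentsD(3) in auto)
    then show ?thesis using False mean i k by (simp add: power2_eq_square)
  qed (simp add: power2_eq_square)
  have int: "integrable M (\<lambda>\<omega>. V i \<omega> * V k \<omega>)" if "i < n" "k < n" for i k
    by (intro finite_momentsD(3) finite_moments_mult mom that)
  have "expectation (\<lambda>\<omega>. (\<Sum>i<n. V i \<omega>)\<^sup>2) = expectation (\<lambda>\<omega>. \<Sum>i<n. \<Sum>k<n. V i \<omega> * V k \<omega>)"
    by (simp add: power2_eq_square sum_product)
  also have "\<dots> = (\<Sum>i<n. \<Sum>k<n. expectation (\<lambda>\<omega>. V i \<omega> * V k \<omega>))"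
  proof -
    have "expectation (\<lambda>\<omega>. \<Sum>i<n. \<Sum>k<n. V i \<omega> * V k \<omega>) =
        (\<Sum>i<n. expectation (\<lambda>\<omega>. \<Sum>k<n. V i \<omega> * V k \<omega>))"
      by (rule Bochner_Integration.integral_sum) (auto intro!: Bochner_Integration.integrable_sum int)
    also have "\<dots> = (\<Sum>i<n. \<Sum>k<n. expectation (\<lambda>\<omega>. V i \<omega> * V k \<omega>))"
      by (intro sum.cong refl Bochner_Integration.integral_sum) (auto intro!: int)
    finally show ?thesis .
  qed
  also have "\<dots> = (\<Sum>i<n. \<Sum>k<n. (if i = k then expectation (\<lambda>\<omega>. (V i \<omega>)\<^sup>2) - m\<^sup>2 else 0) + m\<^sup>2)"
    by (intro sum.cong refl cross) auto
  also have "\<dots> = (\<Sum>i<n. expectation (\<lambda>\<omega>. (V i \<omega>)\<^sup>2)) + real n * (real n - 1) * m\<^sup>2"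
    by (simp add: sum.distrib sum_subtractf algebra_simps)
  finally show ?thesis .
qed

end

section \<open>Moments of normal laws\<close>

text \<open>
  The point mass at zero obeys the same formulas as the nondegenerate laws, also for \<open>k = 0\<close>
  because \<open>0 ^ 0 = 1\<close>. This spares a case distinction on \<open>\<sigma>\<^sup>2 = 0\<close> and \<open>\<beta> = 0\<close> in the moment bounds.
\<close>

lemma normal_law_moments:
  assumes "0 \<le> v"
  shows "has_bochner_integral (normal_law 0 v) (\<lambda>x. x ^ (2 * k)) (fact (2 * k) / (2 ^ k * fact k) * v ^ k)"
    and "has_bochner_integral (normal_law 0 v) (\<lambda>x. x ^ (2 * k + 1)) 0"
    and "integrable (normal_law 0 v) (\<lambda>x. \<bar>x\<bar> ^ r)"
proof -
  have ret: "has_bochner_integral (return borel 0) f (f 0)" if "f \<in> borel_measurable borel" for f :: "real \<Rightarrow> real"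
  proof -
    interpret prob_space "return borel (0::real)" by (rule prob_space_return) simp
    have "has_bochner_integral (return borel (0::real)) (\<lambda>_. f 0) (f 0)"
      using prob_space by (simp add: has_bochner_integral_iff)
    then show ?thesis
      by (subst has_bochner_integral_cong_AE[where g = "\<lambda>_. f 0"])
        (use that in \<open>auto simp: AE_return measurable_return1\<close>)
  qed
  have dens: "has_bochner_integral (normal_law 0 v) f c"
    if "v \<noteq> 0" "f \<in> borel_measurable borel"
      "has_bochner_integral lborel (\<lambda>x. normal_density 0 (sqrt v) x * f x) c" for f c
    unfolding normal_law_def using that by (auto intro!: has_bochner_integral_density)
  have pos: "0 < sqrt v" if "v \<noteq> 0" using that assms by simp
  show "has_bochner_integral (normal_law 0 v) (\<lambda>x. x ^ (2 * k)) (fact (2 * k) / (2 ^ k * fact k) * v ^ k)"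
  proof (cases "v = 0")
    case True
    then show ?thesis
      using ret[of "\<lambda>x. x ^ (2 * k)"] by (cases k) (simp_all add: normal_law_def)
  next
    case False
    then show ?thesis
      using normal_moment_even[OF pos[OF False], of 0 k] assms
      by (intro dens) (simp_all add: power_divide)
  qed
  show "has_bochner_integral (normal_law 0 v) (\<lambda>x. x ^ (2 * k + 1)) 0"
  proof (cases "v = 0")
    case True
    then show ?thesis
      using ret[of "\<lambda>x. x ^ (2 * k + 1)"] by (simp add: normal_law_def)
  next
    case False
    then show ?thesis
      using normal_moment_odd[OF pos[OF False], of 0 k] by (intro dens) simp_all
  qed
  show "integrable (normal_law 0 v) (\<lambda>x. \<bar>x\<bar> ^ r)"
  proof (cases "v = 0")
    case True
    have "integrable (return borel 0) (\<lambda>x::real. \<bar>x\<bar> ^ r)"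
      by (rule integrable.intros[OF ret]) simp
    with True show ?thesis by (simp add: normal_law_def)
  next
    case False
    have "integrable lborel (\<lambda>x. normal_density 0 (sqrt v) x * \<bar>x\<bar> ^ r)"
      using integrable_normal_moment_abs[OF pos[OF False], of 0 r] by simp
    from integrable.intros[OF dens[OF False _ has_bochner_integral_integrable[OF this]]]
    show ?thesis by simp
  qed
qed

context prob_space
begin

lemma normal_law_expectation:
  assumes [measurable]: "Z \<in> borel_measurable M" and law: "distr M borel Z = normal_law 0 v" and v: "0 \<le> v"
  shows "expectation (\<lambda>\<omega>. Z \<omega> ^ (2 * k)) = fact (2 * k) / (2 ^ k * fact k) * v ^ k"
    and "expectation (\<lambda>\<omega>. Z \<omega> ^ (2 * k + 1)) = 0"
    and "finite_moments Z"
proof -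
  have tr: "expectation (\<lambda>\<omega>. f (Z \<omega>)) = integral\<^sup>L (normal_law 0 v) f"
    if "f \<in> borel_measurable borel" for f :: "real \<Rightarrow> real"
    unfolding law[symmetric] using that by (subst integral_distr) auto
  show "expectation (\<lambda>\<omega>. Z \<omega> ^ (2 * k)) = fact (2 * k) / (2 ^ k * fact k) * v ^ k"
    by (rule trans[OF tr has_bochner_integral_integral_eq[OF normal_law_moments(1)[OF v]]]) measurable
  show "expectation (\<lambda>\<omega>. Z \<omega> ^ (2 * k + 1)) = 0"
    by (rule trans[OF tr has_bochner_integral_integral_eq[OF normal_law_moments(2)[OF v]]]) measurable
  have "integrable M (\<lambda>\<omega>. \<bar>Z \<omega>\<bar> ^ r)" for r
    using normal_law_moments(3)[OF v, of r] unfolding law[symmetric]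
    by (subst (asm) integrable_distr_eq) auto
  then show "finite_moments Z" by (simp add: finite_moments_def)
qed

end

lemma even_moment_factors:
  "fact (2 * 1) / (2 ^ 1 * fact 1) = (1::real)"
  "fact (2 * 2) / (2 ^ 2 * fact 2) = (3::real)"
  "fact (2 * 3) / (2 ^ 3 * fact 3) = (15::real)"
  "fact (2 * 4) / (2 ^ 4 * fact 4) = (105::real)"
  by (simp_all add: fact_numeral)

section \<open>Polynomials in a standard Gaussian vector\<close>

definition linear_form :: "(nat \<Rightarrow> real) \<Rightarrow> nat \<Rightarrow> (nat \<Rightarrow> real) \<Rightarrow> real" where
  "linear_form b m z = (\<Sum>j<m. b j * z j)"

locale gaussian_vector = prob_space M for M :: "'a measure" +
  fixes p :: nat and Z :: "'a \<Rightarrow> nat \<Rightarrow> real"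
  assumes indep: "indep_vars (\<lambda>_. borel) (\<lambda>j \<omega>. Z \<omega> j) {..<p}"
    and law: "\<And>j. j < p \<Longrightarrow> distr M borel (\<lambda>\<omega>. Z \<omega> j) = normal_law 0 1"
begin

lemma coordinate_measurable: "j < p \<Longrightarrow> (\<lambda>\<omega>. Z \<omega> j) \<in> borel_measurable M"
  using indep by (auto simp: indep_vars_def)

lemma coordinate_moments:
  assumes j: "j < p"
  shows "finite_moments (\<lambda>\<omega>. Z \<omega> j)"
    and "expectation (\<lambda>\<omega>. Z \<omega> j) = 0"
    and "expectation (\<lambda>\<omega>. (Z \<omega> j)\<^sup>2) = 1"
    and "expectation (\<lambda>\<omega>. Z \<omega> j ^ 4) = 3"
    and "expectation (\<lambda>\<omega>. Z \<omega> j ^ 6) = 15"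
    and "expectation (\<lambda>\<omega>. Z \<omega> j ^ 8) = 105"
proof -
  note E = normal_law_expectation[OF coordinate_measurable[OF j] law[OF j]]
  show "finite_moments (\<lambda>\<omega>. Z \<omega> j)" by (rule E) simp
  show "expectation (\<lambda>\<omega>. Z \<omega> j) = 0" using E(2)[of 0] by simp
  show "expectation (\<lambda>\<omega>. (Z \<omega> j)\<^sup>2) = 1" using E(1)[of 1, unfolded even_moment_factors] by simp
  show "expectation (\<lambda>\<omega>. Z \<omega> j ^ 4) = 3" using E(1)[of 2, unfolded even_moment_factors] by simp
  show "expectation (\<lambda>\<omega>. Z \<omega> j ^ 6) = 15" using E(1)[of 3, unfolded even_moment_factors] by simp
  show "expectation (\<lambda>\<omega>. Z \<omega> j ^ 8) = 105" using E(1)[of 4, unfolded even_moment_factors] by simp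
qed

lemma linear_form_finite_moments: "m \<le> p \<Longrightarrow> finite_moments (\<lambda>\<omega>. linear_form b m (Z \<omega>))"
  unfolding linear_form_def by (intro finite_moments_intros coordinate_moments) auto

lemma norm_excess_finite_moments: "m \<le> p \<Longrightarrow> finite_moments (\<lambda>\<omega>. norm_excess m (Z \<omega>))"
  unfolding norm_excess_def by (intro finite_moments_intros coordinate_moments) auto

text \<open>
  Coordinates with vanishing coefficient are discarded first: such a summand has no density, and
  the additivity of independent normal laws is a statement about their densities.
\<close>

lemma linear_form_law: "distr M borel (\<lambda>\<omega>. linear_form b p (Z \<omega>)) = normal_law 0 (signal_level p b)"
proof -
  define I where "I = {j. j < p \<and> b j \<noteq> 0}"
  have fin: "finite I" and sub: "I \<subseteq> {..<p}" by (auto simp: I_def)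
  have form_I: "linear_form b p (Z \<omega>) = (\<Sum>j\<in>I. b j * Z \<omega> j)" for \<omega>
    unfolding linear_form_def I_def by (auto intro!: sum.mono_neutral_right)
  have level_I: "signal_level p b = (\<Sum>j\<in>I. \<bar>b j\<bar>\<^sup>2)"
    unfolding signal_level_def I_def by (auto intro!: sum.mono_neutral_right)
  show ?thesis
  proof (cases "I = {}")
    case True
    have "distr M borel (\<lambda>_. 0::real) = return borel 0"
      by (intro distr_const) simp_all
    then show ?thesis using True by (simp add: form_I level_I normal_law_def)
  next
    case False
    have "distributed M lborel (\<lambda>\<omega>. \<Sum>j\<in>I. b j * Z \<omega> j)
        (normal_density (\<Sum>j\<in>I. 0) (sqrt (\<Sum>j\<in>I. \<bar>b j\<bar>\<^sup>2)))"
    proof (rule sum_indep_normal[OF fin False])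
      show "indep_vars (\<lambda>i. borel) (\<lambda>j \<omega>. b j * Z \<omega> j) I"
        by (rule indep_vars_compose2[OF indep_vars_subset[OF indep sub], where Y = "\<lambda>j x. b j * x"]) simp
      fix j assume j: "j \<in> I"
      then show "0 < \<bar>b j\<bar>" by (simp add: I_def)
      have "j < p" "b j \<noteq> 0" using j by (auto simp: I_def)
      have "distributed M lborel (\<lambda>\<omega>. Z \<omega> j) std_normal_density"
        using law[OF \<open>j < p\<close>] coordinate_measurable[OF \<open>j < p\<close>]
        by (simp add: distributed_def normal_law_def cong: distr_cong)
      from normal_density_affine[OF this, of "b j" 0] \<open>b j \<noteq> 0\<close>
      show "distributed M lborel (\<lambda>\<omega>. b j * Z \<omega> j) (normal_density 0 \<bar>b j\<bar>)" by simp
    qed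
    moreover have "signal_level p b \<noteq> 0"
      unfolding level_I using fin False by (subst sum_nonneg_eq_0_iff) (auto simp: I_def)
    ultimately show ?thesis
      by (simp add: form_I level_I normal_law_def distributed_def cong: distr_cong)
  qed
qed

text \<open>
  The mixed moments of \<open>\<parallel>Z\<parallel>\<^sup>2 - p\<close> and \<open>b\<^sup>T Z\<close> are computed by adding one coordinate at a time. The
  new coordinate is independent of the pair of partial sums, which makes every mixed term factor.
\<close>

lemma expectation_times_next_coordinate:
  assumes m: "m < p" and g[measurable]: "g \<in> borel_measurable borel"
    and fin: "finite_moments (\<lambda>\<omega>. g (Z \<omega> m))"
  shows "expectation (\<lambda>\<omega>. (norm_excess m (Z \<omega>) ^ r * linear_form b m (Z \<omega>) ^ s) * g (Z \<omega> m)) =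
    expectation (\<lambda>\<omega>. norm_excess m (Z \<omega>) ^ r * linear_form b m (Z \<omega>) ^ s) * expectation (\<lambda>\<omega>. g (Z \<omega> m))"
proof -
  define F where "F z = norm_excess m z ^ r * linear_form b m z ^ s" for z
  have "indep_var
      borel (F \<circ> (\<lambda>\<omega>. restrict (\<lambda>j. Z \<omega> j) {..<m}))
      borel ((\<lambda>x. g (x m)) \<circ> (\<lambda>\<omega>. restrict (\<lambda>j. Z \<omega> j) {m}))"
  proof (rule indep_var_compose[OF indep_var_restrict[OF indep]])
    show "F \<in> borel_measurable (PiM {..<m} (\<lambda>_. borel))"
      unfolding F_def norm_excess_def linear_form_def by measurable
    show "(\<lambda>x. g (x m)) \<in> borel_measurable (PiM {m} (\<lambda>_. borel))" by measurable
  qed (use m in auto)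
  also have "F \<circ> (\<lambda>\<omega>. restrict (\<lambda>j. Z \<omega> j) {..<m}) = (\<lambda>\<omega>. norm_excess m (Z \<omega>) ^ r * linear_form b m (Z \<omega>) ^ s)"
    by (simp add: F_def norm_excess_def linear_form_def fun_eq_iff)
  also have "(\<lambda>x. g (x m)) \<circ> (\<lambda>\<omega>. restrict (\<lambda>j. Z \<omega> j) {m}) = (\<lambda>\<omega>. g (Z \<omega> m))"
    by (simp add: fun_eq_iff)
  finally show ?thesis
    by (rule indep_var_lebesgue_integral)
      (use m in \<open>auto intro!: finite_momentsD(3) finite_moments_intros fin norm_excess_finite_moments linear_form_finite_moments\<close>)
qed

lemma centered_square_moments:
  assumes j: "j < p"
  shows "expectation (\<lambda>\<omega>. (Z \<omega> j)\<^sup>2 - 1) = 0"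
    and "expectation (\<lambda>\<omega>. ((Z \<omega> j)\<^sup>2 - 1)\<^sup>2) = 2"
    and "expectation (\<lambda>\<omega>. ((Z \<omega> j)\<^sup>2 - 1) ^ 4) = 60"
    and "expectation (\<lambda>\<omega>. ((Z \<omega> j)\<^sup>2 - 1) * (Z \<omega> j)\<^sup>2) = 2"
proof -
  note int = finite_momentsD(2)[OF coordinate_moments(1)[OF j]]
  note mom = coordinate_moments[OF j]
  show "expectation (\<lambda>\<omega>. (Z \<omega> j)\<^sup>2 - 1) = 0"
    using int mom by (simp add: prob_space)
  have "(\<lambda>\<omega>. ((Z \<omega> j)\<^sup>2 - 1)\<^sup>2) = (\<lambda>\<omega>. Z \<omega> j ^ 4 - 2 * (Z \<omega> j)\<^sup>2 + 1)"
    by (intro ext) algebra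
  then show "expectation (\<lambda>\<omega>. ((Z \<omega> j)\<^sup>2 - 1)\<^sup>2) = 2"
    using int mom by (simp add: prob_space)
  have "(\<lambda>\<omega>. ((Z \<omega> j)\<^sup>2 - 1) ^ 4) =
      (\<lambda>\<omega>. Z \<omega> j ^ 8 - 4 * Z \<omega> j ^ 6 + 6 * Z \<omega> j ^ 4 - 4 * (Z \<omega> j)\<^sup>2 + 1)"
    by (intro ext) algebra
  then show "expectation (\<lambda>\<omega>. ((Z \<omega> j)\<^sup>2 - 1) ^ 4) = 60"
    using int mom by (simp add: prob_space)
  have "(\<lambda>\<omega>. ((Z \<omega> j)\<^sup>2 - 1) * (Z \<omega> j)\<^sup>2) = (\<lambda>\<omega>. Z \<omega> j ^ 4 - (Z \<omega> j)\<^sup>2)"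
    by (intro ext) algebra
  then show "expectation (\<lambda>\<omega>. ((Z \<omega> j)\<^sup>2 - 1) * (Z \<omega> j)\<^sup>2) = 2"
    using int mom by (simp add: prob_space)
qed

lemma expectation_norm_excess: "m \<le> p \<Longrightarrow> expectation (\<lambda>\<omega>. norm_excess m (Z \<omega>)) = 0"
  unfolding norm_excess_def
  by (subst Bochner_Integration.integral_sum)
    (auto simp: centered_square_moments intro!: finite_momentsD(3) finite_moments_intros coordinate_moments)

lemma expectation_linear_form: "m \<le> p \<Longrightarrow> expectation (\<lambda>\<omega>. linear_form b m (Z \<omega>)) = 0"
  unfolding linear_form_def
  by (subst Bochner_Integration.integral_sum)
    (auto simp: coordinate_moments intro!: finite_momentsD(3) finite_moments_intros coordinate_moments)

lemma expectation_norm_excess_square: "m \<le> p \<Longrightarrow> expectation (\<lambda>\<omega>. (norm_excess m (Z \<omega>))\<^sup>2) = 2 * real m"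
proof (induction m)
  case 0
  show ?case by (simp add: norm_excess_def)
next
  case (Suc m)
  then have m: "m < p" by simp
  define \<xi> where "\<xi> \<omega> = (Z \<omega> m)\<^sup>2 - 1" for \<omega>
  have fin: "finite_moments \<xi>" "finite_moments (\<lambda>\<omega>. norm_excess m (Z \<omega>))"
    unfolding \<xi>_def[abs_def] using m by (auto intro!: finite_moments_intros coordinate_moments norm_excess_finite_moments)
  note int = fin[THEN finite_momentsD(2)] finite_momentsD(3)[OF finite_moments_mult[OF fin(2) fin(1)]]
  have "expectation (\<lambda>\<omega>. norm_excess m (Z \<omega>) * \<xi> \<omega>) = 0"
    using expectation_times_next_coordinate[OF m, of "\<lambda>x. x\<^sup>2 - 1" 1 b 0] fin expectation_norm_excess[of m] m
    by (simp add: \<xi>_def[abs_def])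
  moreover have "(\<lambda>\<omega>. (norm_excess (Suc m) (Z \<omega>))\<^sup>2) = (\<lambda>\<omega>. (norm_excess m (Z \<omega>))\<^sup>2 + 2 * (norm_excess m (Z \<omega>) * \<xi> \<omega>) + (\<xi> \<omega>)\<^sup>2)"
    by (simp add: fun_eq_iff norm_excess_def \<xi>_def power2_sum)
  ultimately show ?case
    using Suc m int centered_square_moments(2)[OF m, folded \<xi>_def] by simp
qed

text \<open>
  With \<open>S\<close> the partial sum and \<open>\<xi> = Z\<^sub>m\<^sup>2 - 1\<close>, only the even terms of \<open>(S + \<xi>)\<^sup>4\<close> survive, because
  \<open>E S = E \<xi> = 0\<close>. The recursion is \<open>E S\<^sup>4 + 6 (2 m) 2 + 60\<close>, so the fourth moment is quadratic in
  the dimension and not quartic.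
\<close>

lemma expectation_norm_excess_fourth: "m \<le> p \<Longrightarrow> expectation (\<lambda>\<omega>. norm_excess m (Z \<omega>) ^ 4) = 12 * (real m)\<^sup>2 + 48 * real m"
proof (induction m)
  case 0
  show ?case by (simp add: norm_excess_def)
next
  case (Suc m)
  then have m: "m < p" by simp
  define \<xi> where "\<xi> \<omega> = (Z \<omega> m)\<^sup>2 - 1" for \<omega>
  have fin: "finite_moments \<xi>" "finite_moments (\<lambda>\<omega>. norm_excess m (Z \<omega>))"
    unfolding \<xi>_def[abs_def] using m by (auto intro!: finite_moments_intros coordinate_moments norm_excess_finite_moments)
  have int: "integrable M (\<lambda>\<omega>. norm_excess m (Z \<omega>) ^ r * \<xi> \<omega> ^ s)" for r s
    by (intro finite_momentsD(3) finite_moments_intros fin)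
  have split: "expectation (\<lambda>\<omega>. norm_excess m (Z \<omega>) ^ r * \<xi> \<omega> ^ s) =
      expectation (\<lambda>\<omega>. norm_excess m (Z \<omega>) ^ r) * expectation (\<lambda>\<omega>. \<xi> \<omega> ^ s)" for r s
    using expectation_times_next_coordinate[OF m, of "\<lambda>x. (x\<^sup>2 - 1) ^ s" r b 0]
      finite_moments_power[OF fin(1)]
    by (simp add: \<xi>_def[abs_def])
  note mom = centered_square_moments[OF m, folded \<xi>_def]
  have "(\<lambda>\<omega>. norm_excess (Suc m) (Z \<omega>) ^ 4) = (\<lambda>\<omega>. norm_excess m (Z \<omega>) ^ 4 * \<xi> \<omega> ^ 0 + 4 * (norm_excess m (Z \<omega>) ^ 3 * \<xi> \<omega> ^ 1)
      + 6 * (norm_excess m (Z \<omega>) ^ 2 * \<xi> \<omega> ^ 2) + 4 * (norm_excess m (Z \<omega>) ^ 1 * \<xi> \<omega> ^ 3) + norm_excess m (Z \<omega>) ^ 0 * \<xi> \<omega> ^ 4)"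
  proof
    fix \<omega>
    have "norm_excess (Suc m) (Z \<omega>) = norm_excess m (Z \<omega>) + \<xi> \<omega>" by (simp add: norm_excess_def \<xi>_def)
    moreover have "(a + b) ^ 4 = a ^ 4 * b ^ 0 + 4 * (a ^ 3 * b ^ 1)
      + 6 * (a ^ 2 * b ^ 2) + 4 * (a ^ 1 * b ^ 3) + a ^ 0 * b ^ 4" for a b :: real by algebra
    ultimately show "norm_excess (Suc m) (Z \<omega>) ^ 4 = norm_excess m (Z \<omega>) ^ 4 * \<xi> \<omega> ^ 0 + 4 * (norm_excess m (Z \<omega>) ^ 3 * \<xi> \<omega> ^ 1)
      + 6 * (norm_excess m (Z \<omega>) ^ 2 * \<xi> \<omega> ^ 2) + 4 * (norm_excess m (Z \<omega>) ^ 1 * \<xi> \<omega> ^ 3) + norm_excess m (Z \<omega>) ^ 0 * \<xi> \<omega> ^ 4"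
      by simp
  qed
  moreover have "has_bochner_integral M (\<lambda>\<omega>. norm_excess m (Z \<omega>) ^ r * \<xi> \<omega> ^ s)
      (expectation (\<lambda>\<omega>. norm_excess m (Z \<omega>) ^ r) * expectation (\<lambda>\<omega>. \<xi> \<omega> ^ s))" for r s
    unfolding split[symmetric] by (rule has_bochner_integral_integrable[OF int])
  ultimately have "expectation (\<lambda>\<omega>. norm_excess (Suc m) (Z \<omega>) ^ 4) =
      expectation (\<lambda>\<omega>. norm_excess m (Z \<omega>) ^ 4) * expectation (\<lambda>\<omega>. \<xi> \<omega> ^ 0)
      + 4 * (expectation (\<lambda>\<omega>. norm_excess m (Z \<omega>) ^ 3) * expectation (\<lambda>\<omega>. \<xi> \<omega> ^ 1))
      + 6 * (expectation (\<lambda>\<omega>. norm_excess m (Z \<omega>) ^ 2) * expectation (\<lambda>\<omega>. \<xi> \<omega> ^ 2))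
      + 4 * (expectation (\<lambda>\<omega>. norm_excess m (Z \<omega>) ^ 1) * expectation (\<lambda>\<omega>. \<xi> \<omega> ^ 3))
      + expectation (\<lambda>\<omega>. norm_excess m (Z \<omega>) ^ 0) * expectation (\<lambda>\<omega>. \<xi> \<omega> ^ 4)"
    by (simp only:) (intro has_bochner_integral_integral_eq has_bochner_integral_add has_bochner_integral_mult_right)
  also have "\<dots> = (12 * (real m)\<^sup>2 + 48 * real m) + 6 * (2 * real m * 2) + 60"
    using Suc m mom expectation_norm_excess[of m] expectation_norm_excess_square[of m]
    by (simp add: prob_space)
  finally show ?case by (simp add: power2_eq_square algebra_simps)
qed

text \<open>
  In the expansion with one more coordinate \<open>x\<close>, each term contains a centered independent factor
  except the previous value and \<open>b\<^sub>m\<^sup>2 E ((x\<^sup>2 - 1) x\<^sup>2) = 2 b\<^sub>m\<^sup>2\<close>.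
\<close>

lemma expectation_norm_excess_linear_form_square:
  "m \<le> p \<Longrightarrow> expectation (\<lambda>\<omega>. norm_excess m (Z \<omega>) * (linear_form b m (Z \<omega>))\<^sup>2) = 2 * signal_level m b"
proof (induction m)
  case 0
  show ?case by (simp add: norm_excess_def signal_level_def)
next
  case (Suc m)
  then have m: "m < p" by simp
  define x where "x \<omega> = Z \<omega> m" for \<omega>
  have fin: "finite_moments x" "finite_moments (\<lambda>\<omega>. norm_excess m (Z \<omega>))" "finite_moments (\<lambda>\<omega>. linear_form b m (Z \<omega>))"
    unfolding x_def[abs_def] using m by (auto intro!: coordinate_moments norm_excess_finite_moments linear_form_finite_moments)
  have next_coordinate: "has_bochner_integral M (\<lambda>\<omega>. (norm_excess m (Z \<omega>) ^ r * linear_form b m (Z \<omega>) ^ s) * g (x \<omega>))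
      (expectation (\<lambda>\<omega>. norm_excess m (Z \<omega>) ^ r * linear_form b m (Z \<omega>) ^ s) * expectation (\<lambda>\<omega>. g (x \<omega>)))"
    if "g \<in> borel_measurable borel" "finite_moments (\<lambda>\<omega>. g (x \<omega>))" for r s g
    using expectation_times_next_coordinate[OF m that(1) that(2)[unfolded x_def], of r b s, folded x_def]
      finite_momentsD(3)[OF finite_moments_mult[OF finite_moments_mult[OF
        finite_moments_power[OF fin(2)] finite_moments_power[OF fin(3)]] that(2)]]
    by (simp add: has_bochner_integral_iff)
  have H: "has_bochner_integral M (\<lambda>\<omega>. (norm_excess m (Z \<omega>) ^ r * linear_form b m (Z \<omega>) ^ s) * x \<omega> ^ k)
      (expectation (\<lambda>\<omega>. norm_excess m (Z \<omega>) ^ r * linear_form b m (Z \<omega>) ^ s) * expectation (\<lambda>\<omega>. x \<omega> ^ k))"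
    "has_bochner_integral M (\<lambda>\<omega>. (norm_excess m (Z \<omega>) ^ r * linear_form b m (Z \<omega>) ^ s) * (((x \<omega>)\<^sup>2 - 1) * x \<omega> ^ k))
      (expectation (\<lambda>\<omega>. norm_excess m (Z \<omega>) ^ r * linear_form b m (Z \<omega>) ^ s) * expectation (\<lambda>\<omega>. ((x \<omega>)\<^sup>2 - 1) * x \<omega> ^ k))" for r s k
    by (rule next_coordinate; auto intro!: finite_moments_intros fin(1))+
  note mom = centered_square_moments[OF m, folded x_def] coordinate_moments(2,3)[OF m, folded x_def]
  have "(\<lambda>\<omega>. norm_excess (Suc m) (Z \<omega>) * (linear_form b (Suc m) (Z \<omega>))\<^sup>2) = (\<lambda>\<omega>.
      (norm_excess m (Z \<omega>) ^ 1 * linear_form b m (Z \<omega>) ^ 2) * x \<omega> ^ 0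
      + (2 * b m) * ((norm_excess m (Z \<omega>) ^ 1 * linear_form b m (Z \<omega>) ^ 1) * x \<omega> ^ 1)
      + (b m)\<^sup>2 * ((norm_excess m (Z \<omega>) ^ 1 * linear_form b m (Z \<omega>) ^ 0) * x \<omega> ^ 2)
      + (norm_excess m (Z \<omega>) ^ 0 * linear_form b m (Z \<omega>) ^ 2) * (((x \<omega>)\<^sup>2 - 1) * x \<omega> ^ 0)
      + (2 * b m) * ((norm_excess m (Z \<omega>) ^ 0 * linear_form b m (Z \<omega>) ^ 1) * (((x \<omega>)\<^sup>2 - 1) * x \<omega> ^ 1))
      + (b m)\<^sup>2 * ((norm_excess m (Z \<omega>) ^ 0 * linear_form b m (Z \<omega>) ^ 0) * (((x \<omega>)\<^sup>2 - 1) * x \<omega> ^ 2)))"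
    by (simp add: fun_eq_iff norm_excess_def linear_form_def x_def power2_eq_square algebra_simps)
  then have "expectation (\<lambda>\<omega>. norm_excess (Suc m) (Z \<omega>) * (linear_form b (Suc m) (Z \<omega>))\<^sup>2) =
      expectation (\<lambda>\<omega>. norm_excess m (Z \<omega>) ^ 1 * linear_form b m (Z \<omega>) ^ 2) * expectation (\<lambda>\<omega>. x \<omega> ^ 0)
      + (2 * b m) * (expectation (\<lambda>\<omega>. norm_excess m (Z \<omega>) ^ 1 * linear_form b m (Z \<omega>) ^ 1) * expectation (\<lambda>\<omega>. x \<omega> ^ 1))
      + (b m)\<^sup>2 * (expectation (\<lambda>\<omega>. norm_excess m (Z \<omega>) ^ 1 * linear_form b m (Z \<omega>) ^ 0) * expectation (\<lambda>\<omega>. x \<omega> ^ 2))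
      + expectation (\<lambda>\<omega>. norm_excess m (Z \<omega>) ^ 0 * linear_form b m (Z \<omega>) ^ 2) * expectation (\<lambda>\<omega>. ((x \<omega>)\<^sup>2 - 1) * x \<omega> ^ 0)
      + (2 * b m) * (expectation (\<lambda>\<omega>. norm_excess m (Z \<omega>) ^ 0 * linear_form b m (Z \<omega>) ^ 1) * expectation (\<lambda>\<omega>. ((x \<omega>)\<^sup>2 - 1) * x \<omega> ^ 1))
      + (b m)\<^sup>2 * (expectation (\<lambda>\<omega>. norm_excess m (Z \<omega>) ^ 0 * linear_form b m (Z \<omega>) ^ 0) * expectation (\<lambda>\<omega>. ((x \<omega>)\<^sup>2 - 1) * x \<omega> ^ 2))"
    by (simp only:)
      (intro has_bochner_integral_integral_eq has_bochner_integral_add has_bochner_integral_mult_right H)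
  also have "\<dots> = 2 * signal_level m b + (b m)\<^sup>2 * 2"
    using Suc m mom expectation_norm_excess[of m] expectation_linear_form[of m]
    by (simp add: prob_space)
  finally show ?case by (simp add: signal_level_def)
qed

end

text \<open>
  A product law means independent coordinates. Dimension zero is treated apart because the
  characterization of independence by the joint law requires a nonempty index set.
\<close>

lemma (in prob_space) gaussian_vectorI:
  assumes Z: "Z \<in> measurable M (vec_borel p)" and law: "distr M (vec_borel p) Z = std_normal_vec p"
  shows "gaussian_vector M p Z"
proof
  let ?N = "density lborel (\<lambda>x. ennreal (std_normal_density x))"
  have N: "prob_space ?N" by (rule prob_space_normal_density) simp
  interpret N: product_prob_space "\<lambda>_::nat. ?N" "{..<p}"
    by (intro product_prob_spaceI N)
  have coord: "(\<lambda>\<omega>. Z \<omega> j) \<in> borel_measurable M" if "j < p" for j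
    using measurable_compose[OF Z measurable_component_singleton[of j "{..<p}" "\<lambda>_. borel"]] that by simp
  have one: "distr M borel (\<lambda>\<omega>. Z \<omega> j) = ?N" if j: "j < p" for j
  proof -
    have "distr M borel (\<lambda>\<omega>. Z \<omega> j) = distr (distr M (vec_borel p) Z) borel (\<lambda>x. x j)"
      using j by (subst distr_distr) (auto simp: Z comp_def)
    also have "\<dots> = distr (PiM {..<p} (\<lambda>_. ?N)) ?N (\<lambda>x. x j)"
      unfolding law std_normal_vec_def by (rule distr_cong) auto
    also have "\<dots> = ?N"
      using j N by (intro distr_PiM_component) auto
    finally show ?thesis .
  qed
  then show "distr M borel (\<lambda>\<omega>. Z \<omega> j) = normal_law 0 1" if "j < p" for j
    using that by (simp add: normal_law_def)
  show "indep_vars (\<lambda>_. borel) (\<lambda>j \<omega>. Z \<omega> j) {..<p}"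
  proof (cases "p = 0")
    case True
    then show ?thesis by (simp add: indep_vars_def indep_sets_def)
  next
    case False
    have "distr M (vec_borel p) (\<lambda>\<omega>. \<lambda>j\<in>{..<p}. Z \<omega> j) = distr M (vec_borel p) Z"
      using measurable_space[OF Z] by (intro distr_cong) (auto simp: space_PiM intro!: PiE_restrict)
    also have "\<dots> = PiM {..<p} (\<lambda>j. distr M borel (\<lambda>\<omega>. Z \<omega> j))"
      unfolding law std_normal_vec_def by (intro PiM_cong) (auto simp: one)
    finally show ?thesis
      using False coord by (subst indep_vars_iff_distr_eq_PiM') auto
  qed
qed

section \<open>The linear model with Gaussian covariates and noise\<close>

locale gaussian_linear_model = linear_model +
  assumes gaussian_covariates: "\<And>i. i < n \<Longrightarrow> distr M (vec_borel p) (X i) = std_normal_vec p"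
    and gaussian_noise: "\<And>i. i < n \<Longrightarrow> distr M borel (\<epsilon> i) = normal_law 0 \<sigma>2"
begin

lemma covariates_measurable:
  assumes i: "i < n"
  shows "X i \<in> measurable M (vec_borel p)"
proof -
  have "(\<lambda>\<omega>. (X i \<omega>, Y i \<omega>)) \<in> measurable M (vec_borel p \<Otimes>\<^sub>M borel)"
    using independent i by (simp add: indep_vars_def)
  from measurable_compose[OF this measurable_fst] show ?thesis by simp
qed

lemma covariates_gaussian_vector: "i < n \<Longrightarrow> gaussian_vector M p (X i)"
  by (intro gaussian_vectorI covariates_measurable gaussian_covariates)

lemma noise_measurable: "i < n \<Longrightarrow> \<epsilon> i \<in> borel_measurable M"
  using noise_integrable by auto

lemma response_eq:
  "i < n \<Longrightarrow> \<omega> \<in> space M \<Longrightarrow> Y i \<omega> = linear_form \<beta> p (X i \<omega>) + \<epsilon> i \<omega>"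
  by (simp add: linear linear_form_def)

lemma model_finite_moments:
  assumes i: "i < n"
  shows "finite_moments (\<epsilon> i)"
    and "finite_moments (\<lambda>\<omega>. linear_form b p (X i \<omega>))"
    and "finite_moments (\<lambda>\<omega>. norm_excess p (X i \<omega>))"
    and "finite_moments (Y i)"
    and "j < p \<Longrightarrow> finite_moments (\<lambda>\<omega>. X i \<omega> j)"
proof -
  interpret G: gaussian_vector M p "X i" by (rule covariates_gaussian_vector[OF i])
  show e: "finite_moments (\<epsilon> i)"
    by (rule normal_law_expectation(3)[OF noise_measurable[OF i] gaussian_noise[OF i] noise_var_nonneg])
  show "finite_moments (\<lambda>\<omega>. linear_form b p (X i \<omega>))"
    by (rule G.linear_form_finite_moments) simp
  show "finite_moments (\<lambda>\<omega>. norm_excess p (X i \<omega>))"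
    by (rule G.norm_excess_finite_moments) simp
  show "finite_moments (Y i)"
    by (rule finite_moments_cong[OF finite_moments_add[OF G.linear_form_finite_moments[OF order_refl, of \<beta>] e]])
      (simp add: response_eq i)
  show "j < p \<Longrightarrow> finite_moments (\<lambda>\<omega>. X i \<omega> j)"
    by (rule G.coordinate_moments)
qed

text \<open>
  A function of \<open>X\<^sub>i\<close> may be pulled inside the conditional expectation given \<open>X\<^sub>i\<close>. This is the only way
  in which the joint law of noise and covariates is accessible.
\<close>

lemma expectation_times_cond_const:
  assumes i: "i < n" and f: "f \<in> borel_measurable (vec_borel p)"
    and g[measurable]: "g \<in> borel_measurable M" and int: "integrable M (\<lambda>\<omega>. f (X i \<omega>) * g \<omega>)"
    and cond: "AE \<omega> in M. real_cond_exp M (vimage_algebra (space M) (X i) (vec_borel p)) g \<omega> = c"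
  shows "expectation (\<lambda>\<omega>. f (X i \<omega>) * g \<omega>) = c * expectation (\<lambda>\<omega>. f (X i \<omega>))"
proof -
  let ?F = "vimage_algebra (space M) (X i) (vec_borel p)"
  note Xi[measurable] = covariates_measurable[OF i]
  have "finite_measure_subalgebra M ?F"
  proof
    show "subalgebra M ?F"
      using Xi by (simp add: subalgebra_def measurable_iff_sets)
  qed
  then interpret S: sigma_finite_subalgebra M ?F by (rule finite_measure_subalgebra_is_sigma_finite)
  have fX: "(\<lambda>\<omega>. f (X i \<omega>)) \<in> borel_measurable ?F"
    by (rule measurable_compose[OF measurable_vimage_algebra1 f])
      (use measurable_space[OF Xi] in auto)
  have fXM[measurable]: "(\<lambda>\<omega>. f (X i \<omega>)) \<in> borel_measurable M"
    by (rule measurable_compose[OF Xi f])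
  have "expectation (\<lambda>\<omega>. f (X i \<omega>) * g \<omega>) = expectation (\<lambda>\<omega>. f (X i \<omega>) * real_cond_exp M ?F g \<omega>)"
    using S.real_cond_exp_intg(2)[OF int fX g] by simp
  also have "\<dots> = expectation (\<lambda>\<omega>. c * f (X i \<omega>))"
    by (rule integral_cong_AE) (use cond in auto)
  finally show ?thesis by simp
qed

lemma expectation_times_noise:
  assumes i: "i < n" and f: "f \<in> borel_measurable (vec_borel p)" and fm: "finite_moments (\<lambda>\<omega>. f (X i \<omega>))"
  shows "expectation (\<lambda>\<omega>. f (X i \<omega>) * \<epsilon> i \<omega>) = 0"
    and "expectation (\<lambda>\<omega>. f (X i \<omega>) * (\<epsilon> i \<omega>)\<^sup>2) = \<sigma>2 * expectation (\<lambda>\<omega>. f (X i \<omega>))"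
proof -
  note e = model_finite_moments(1)[OF i]
  show "expectation (\<lambda>\<omega>. f (X i \<omega>) * \<epsilon> i \<omega>) = 0"
    by (subst expectation_times_cond_const[OF i f noise_measurable[OF i] _ noise_cond_mean[OF i]])
      (auto intro!: finite_momentsD(3) finite_moments_intros fm e)
  show "expectation (\<lambda>\<omega>. f (X i \<omega>) * (\<epsilon> i \<omega>)\<^sup>2) = \<sigma>2 * expectation (\<lambda>\<omega>. f (X i \<omega>))"
    by (rule expectation_times_cond_const[OF i f _ _ noise_cond_var[OF i]])
      (auto intro!: finite_momentsD(1,3) finite_moments_intros fm e)
qed

lemma linear_form_measurable: "linear_form b p \<in> borel_measurable (vec_borel p)"
  unfolding linear_form_def[abs_def] by measurable

lemma norm_excess_measurable: "norm_excess p \<in> borel_measurable (vec_borel p)"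
  unfolding norm_excess_def[abs_def] by measurable

lemma expectation_times_response_square:
  assumes i: "i < n" and f[measurable]: "f \<in> borel_measurable (vec_borel p)"
    and fm: "finite_moments (\<lambda>\<omega>. f (X i \<omega>))"
  shows "expectation (\<lambda>\<omega>. f (X i \<omega>) * (Y i \<omega>)\<^sup>2) =
    expectation (\<lambda>\<omega>. f (X i \<omega>) * (linear_form \<beta> p (X i \<omega>))\<^sup>2) + \<sigma>2 * expectation (\<lambda>\<omega>. f (X i \<omega>))"
proof -
  note [measurable] = linear_form_measurable
  let ?L = "\<lambda>\<omega>. linear_form \<beta> p (X i \<omega>)"
  note mom = model_finite_moments(1)[OF i] model_finite_moments(2)[OF i] fm
  have "expectation (\<lambda>\<omega>. f (X i \<omega>) * (Y i \<omega>)\<^sup>2) =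
      expectation (\<lambda>\<omega>. f (X i \<omega>) * (?L \<omega>)\<^sup>2 + 2 * (f (X i \<omega>) * ?L \<omega> * \<epsilon> i \<omega>) + f (X i \<omega>) * (\<epsilon> i \<omega>)\<^sup>2)"
    by (rule Bochner_Integration.integral_cong)
      (simp_all add: response_eq i power2_sum algebra_simps)
  also have "\<dots> = expectation (\<lambda>\<omega>. f (X i \<omega>) * (?L \<omega>)\<^sup>2)
      + 2 * expectation (\<lambda>\<omega>. f (X i \<omega>) * ?L \<omega> * \<epsilon> i \<omega>) + expectation (\<lambda>\<omega>. f (X i \<omega>) * (\<epsilon> i \<omega>)\<^sup>2)"
  proof -
    have "integrable M (\<lambda>\<omega>. f (X i \<omega>) * (?L \<omega>)\<^sup>2)" "integrable M (\<lambda>\<omega>. f (X i \<omega>) * ?L \<omega> * \<epsilon> i \<omega>)"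
      "integrable M (\<lambda>\<omega>. f (X i \<omega>) * (\<epsilon> i \<omega>)\<^sup>2)"
      by (intro finite_momentsD(3) finite_moments_intros mom)+
    then show ?thesis by simp
  qed
  also have "expectation (\<lambda>\<omega>. f (X i \<omega>) * ?L \<omega> * \<epsilon> i \<omega>) = 0"
    by (rule expectation_times_noise(1)[OF i, of "\<lambda>z. f z * linear_form \<beta> p z"])
      (auto intro!: finite_moments_intros mom)
  also have "expectation (\<lambda>\<omega>. f (X i \<omega>) * (\<epsilon> i \<omega>)\<^sup>2) = \<sigma>2 * expectation (\<lambda>\<omega>. f (X i \<omega>))"
    by (rule expectation_times_noise(2)[OF i f fm])
  finally show ?thesis by simp
qed

lemma expectation_response_square:
  assumes i: "i < n"
  shows "expectation (\<lambda>\<omega>. (Y i \<omega>)\<^sup>2) = signal_level p \<beta> + \<sigma>2"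
proof -
  interpret G: gaussian_vector M p "X i" by (rule covariates_gaussian_vector[OF i])
  have "expectation (\<lambda>\<omega>. (linear_form \<beta> p (X i \<omega>))\<^sup>2) = signal_level p \<beta>"
    using normal_law_expectation(1)[OF finite_momentsD(1)[OF model_finite_moments(2)[OF i]] G.linear_form_law, where k = 1]
    by (simp add: signal_level_def sum_nonneg)
  then show ?thesis
    using expectation_times_response_square[OF i, of "\<lambda>_. 1"] by (simp add: finite_moments_const prob_space)
qed

text \<open>
  The dimension does not enter: \<open>\<parallel>X\<^sub>i\<parallel>\<^sup>2 - p\<close> is centered, so the noise variance drops out.
\<close>

lemma mean_excess_response:
  assumes i: "i < n"
  shows "expectation (\<lambda>\<omega>. norm_excess p (X i \<omega>) * (Y i \<omega>)\<^sup>2) = 2 * signal_level p \<beta>"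
proof -
  interpret G: gaussian_vector M p "X i" by (rule covariates_gaussian_vector[OF i])
  show ?thesis
    using expectation_times_response_square[OF i norm_excess_measurable model_finite_moments(3)[OF i]]
      G.expectation_norm_excess_linear_form_square[of p \<beta>] G.expectation_norm_excess[of p] by simp
qed

text \<open>
  Signal and noise need not be independent, so \<open>Y\<^sub>i\<close> need not be normal; convexity reduces the
  bound to the eighth moments \<open>105 v\<^sup>4\<close> of the two marginal normal laws.
\<close>

lemma expectation_response_eighth:
  assumes i: "i < n"
  shows "expectation (\<lambda>\<omega>. Y i \<omega> ^ 8) \<le> 13440 * (signal_level p \<beta> + \<sigma>2) ^ 4"
proof -
  interpret G: gaussian_vector M p "X i" by (rule covariates_gaussian_vector[OF i])
  let ?L = "\<lambda>\<omega>. linear_form \<beta> p (X i \<omega>)"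
  note mom = model_finite_moments[OF i]
  have level: "0 \<le> signal_level p \<beta>" by (simp add: signal_level_def sum_nonneg)
  have L8: "expectation (\<lambda>\<omega>. ?L \<omega> ^ 8) = 105 * signal_level p \<beta> ^ 4"
    using normal_law_expectation(1)[OF finite_momentsD(1)[OF mom(2)] G.linear_form_law level, where k = 4,
        unfolded even_moment_factors] by simp
  have e8: "expectation (\<lambda>\<omega>. \<epsilon> i \<omega> ^ 8) = 105 * \<sigma>2 ^ 4"
    using normal_law_expectation(1)[OF noise_measurable[OF i] gaussian_noise[OF i] noise_var_nonneg, of 4,
        unfolded even_moment_factors] by simp
  have pow: "(a + b) ^ 8 \<le> 128 * (a ^ 8 + b ^ 8)" for a b :: real
  proof -
    have sq: "(u + v)\<^sup>2 \<le> 2 * (u\<^sup>2 + v\<^sup>2)" for u v :: real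
      using sum_squares_bound[of u v] by (simp add: power2_sum)
    have "(a + b) ^ 8 = ((a + b)\<^sup>2) ^ 4" by (simp flip: power_mult)
    also have "\<dots> \<le> (2 * (a\<^sup>2 + b\<^sup>2)) ^ 4" by (intro power_mono sq) simp
    also have "\<dots> = 16 * ((a\<^sup>2 + b\<^sup>2)\<^sup>2)\<^sup>2" by algebra
    also have "\<dots> \<le> 16 * (2 * ((a\<^sup>2)\<^sup>2 + (b\<^sup>2)\<^sup>2))\<^sup>2" by (intro mult_left_mono power_mono sq) simp_all
    also have "\<dots> = 64 * (a ^ 4 + b ^ 4)\<^sup>2" by algebra
    also have "\<dots> \<le> 64 * (2 * ((a ^ 4)\<^sup>2 + (b ^ 4)\<^sup>2))" by (intro mult_left_mono sq) simp
    also have "\<dots> = 128 * (a ^ 8 + b ^ 8)" by (simp flip: power_mult)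
    finally show ?thesis .
  qed
  have "expectation (\<lambda>\<omega>. Y i \<omega> ^ 8) \<le> expectation (\<lambda>\<omega>. 128 * (?L \<omega> ^ 8 + \<epsilon> i \<omega> ^ 8))"
  proof (rule integral_mono)
    show "Y i \<omega> ^ 8 \<le> 128 * (?L \<omega> ^ 8 + \<epsilon> i \<omega> ^ 8)" if "\<omega> \<in> space M" for \<omega>
      unfolding response_eq[OF i that] by (rule pow)
  qed (intro finite_momentsD(3) finite_moments_intros mom)+
  also have "\<dots> = 13440 * (signal_level p \<beta> ^ 4 + \<sigma>2 ^ 4)"
    using finite_momentsD(2)[OF mom(1)] finite_momentsD(2)[OF mom(2)] by (simp add: L8 e8)
  also have "\<dots> \<le> 13440 * (signal_level p \<beta> + \<sigma>2) ^ 4"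
  proof -
    have "a ^ 4 + b ^ 4 \<le> (a + b) ^ 4" if "0 \<le> a" "0 \<le> b" for a b :: real
    proof -
      have "(a + b) ^ 4 = a ^ 4 + b ^ 4 + (4 * a ^ 3 * b + 6 * a\<^sup>2 * b\<^sup>2 + 4 * a * b ^ 3)" by algebra
      moreover have "0 \<le> 4 * a ^ 3 * b + 6 * a\<^sup>2 * b\<^sup>2 + 4 * a * b ^ 3" using that by simp
      ultimately show ?thesis by linarith
    qed
    from this[OF level noise_var_nonneg] show ?thesis by simp
  qed
  finally show ?thesis .
qed

text \<open>
  The weight \<open>p + 1\<close> in the inequality of arithmetic and geometric means balances the two
  factors, whose relevant moments are of order \<open>p\<^sup>2\<close> and \<open>1\<close>; it leaves a bound linear in \<open>p\<close>, and it is
  positive also for \<open>p = 0\<close>.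
\<close>

lemma second_moment_excess_response:
  assumes i: "i < n"
  shows "expectation (\<lambda>\<omega>. (norm_excess p (X i \<omega>) * (Y i \<omega>)\<^sup>2)\<^sup>2) \<le>
    (real p + 1) * (12 + 6720 * (signal_level p \<beta> + \<sigma>2) ^ 4)"
proof -
  interpret G: gaussian_vector M p "X i" by (rule covariates_gaussian_vector[OF i])
  note mom = model_finite_moments[OF i]
  define q where "q = real p + 1"
  have q: "0 < q" by (simp add: q_def)
  let ?N = "\<lambda>\<omega>. norm_excess p (X i \<omega>)"
  have young: "(a * b\<^sup>2)\<^sup>2 \<le> (1 / (2 * q)) * a ^ 4 + (q / 2) * b ^ 8" for a b :: real
  proof -
    have "(1 / (2 * q)) * a ^ 4 + (q / 2) * b ^ 8 - (a * b\<^sup>2)\<^sup>2 = (a\<^sup>2 - q * b ^ 4)\<^sup>2 / (2 * q)"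
      using q by (simp add: field_simps) algebra
    moreover have "0 \<le> (a\<^sup>2 - q * b ^ 4)\<^sup>2 / (2 * q)" using q by simp
    ultimately show ?thesis by linarith
  qed
  have "expectation (\<lambda>\<omega>. (?N \<omega> * (Y i \<omega>)\<^sup>2)\<^sup>2) \<le>
      expectation (\<lambda>\<omega>. (1 / (2 * q)) * ?N \<omega> ^ 4 + (q / 2) * Y i \<omega> ^ 8)"
    by (rule integral_mono[OF _ _ young]) (intro finite_momentsD(3) finite_moments_intros mom)+
  also have "\<dots> = (1 / (2 * q)) * expectation (\<lambda>\<omega>. ?N \<omega> ^ 4) + (q / 2) * expectation (\<lambda>\<omega>. Y i \<omega> ^ 8)"
    using finite_momentsD(2)[OF mom(3)] finite_momentsD(2)[OF mom(4)] by simp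
  also have "\<dots> \<le> (1 / (2 * q)) * (24 * q\<^sup>2) + (q / 2) * (13440 * (signal_level p \<beta> + \<sigma>2) ^ 4)"
  proof (intro add_mono mult_left_mono expectation_response_eighth[OF i])
    show "expectation (\<lambda>\<omega>. ?N \<omega> ^ 4) \<le> 24 * q\<^sup>2"
      by (simp add: G.expectation_norm_excess_fourth q_def power2_sum)
  qed (use q in auto)
  also have "\<dots> = q * (12 + 6720 * (signal_level p \<beta> + \<sigma>2) ^ 4)"
    using q by (simp add: field_simps power2_eq_square)
  finally show ?thesis by (simp add: q_def)
qed

lemma expectation_covariate_response:
  assumes i: "i < n" and j: "j < p"
  shows "expectation (\<lambda>\<omega>. X i \<omega> j * Y i \<omega>) = \<beta> j"
proof -
  note mom = model_finite_moments[OF i]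
  have "expectation (\<lambda>\<omega>. X i \<omega> j * Y i \<omega>) =
      expectation (\<lambda>\<omega>. (\<Sum>k<p. \<beta> k * (X i \<omega> j * X i \<omega> k)) + X i \<omega> j * \<epsilon> i \<omega>)"
    by (rule Bochner_Integration.integral_cong)
      (simp_all add: linear i algebra_simps sum_distrib_left)
  also have "\<dots> = expectation (\<lambda>\<omega>. \<Sum>k<p. \<beta> k * (X i \<omega> j * X i \<omega> k)) + expectation (\<lambda>\<omega>. X i \<omega> j * \<epsilon> i \<omega>)"
    by (rule Bochner_Integration.integral_add)
      (auto intro!: finite_momentsD(3) finite_moments_intros mom(1) mom(5) j)
  also have "expectation (\<lambda>\<omega>. X i \<omega> j * \<epsilon> i \<omega>) = 0"
    by (rule expectation_times_noise(1)[OF i, of "\<lambda>z. z j"]) (use j mom(5) in \<open>auto intro!: measurable_component_singleton\<close>)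
  also have "expectation (\<lambda>\<omega>. \<Sum>k<p. \<beta> k * (X i \<omega> j * X i \<omega> k)) =
      (\<Sum>k<p. if k = j then \<beta> k else 0)"
  proof (subst Bochner_Integration.integral_sum)
    show "(\<Sum>k<p. expectation (\<lambda>\<omega>. \<beta> k * (X i \<omega> j * X i \<omega> k))) = (\<Sum>k<p. if k = j then \<beta> k else 0)"
    proof (intro sum.cong refl)
      fix k assume "k \<in> {..<p}"
      then show "expectation (\<lambda>\<omega>. \<beta> k * (X i \<omega> j * X i \<omega> k)) = (if k = j then \<beta> k else 0)"
        using covariate_cov[OF i j, of k] covariate_mean[OF i] j by simp
    qed
  qed (auto intro!: finite_momentsD(3) finite_moments_intros mom(5) j)
  finally show ?thesis using j by simp
qed

lemma expectation_W_square_norm: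
  assumes i: "i < n"
  shows "expectation (\<lambda>\<omega>. \<Sum>j<p. (X i \<omega> j * Y i \<omega>)\<^sup>2) =
    2 * signal_level p \<beta> + real p * (signal_level p \<beta> + \<sigma>2)"
proof -
  note mom = model_finite_moments[OF i]
  have "(\<Sum>j<p. (x j * y)\<^sup>2) = norm_excess p x * y\<^sup>2 + real p * y\<^sup>2" for x and y :: real
    by (simp add: norm_excess_def power_mult_distrib sum_subtractf left_diff_distrib flip: sum_distrib_right)
  then have "expectation (\<lambda>\<omega>. \<Sum>j<p. (X i \<omega> j * Y i \<omega>)\<^sup>2) =
      expectation (\<lambda>\<omega>. norm_excess p (X i \<omega>) * (Y i \<omega>)\<^sup>2) + real p * expectation (\<lambda>\<omega>. (Y i \<omega>)\<^sup>2)"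
    using finite_momentsD(3)[OF finite_moments_mult[OF mom(3) finite_moments_power[OF mom(4), of 2]]]
      finite_momentsD(2)[OF mom(4)] by simp
  then show ?thesis
    by (simp add: mean_excess_response expectation_response_square i)
qed


section \<open>Bounds in mean for the two parts of the difference\<close>

text \<open>
  The cross terms are the square of the sum minus its diagonal. Both are nonnegative with an
  explicit mean, so the triangle inequality gives the bound without any variance computation.
\<close>

lemma expectation_cross_terms:
  shows "expectation (\<lambda>\<omega>. \<bar>(\<Sum>j<p. (\<Sum>i<n. X i \<omega> j * Y i \<omega>)\<^sup>2) - (\<Sum>i<n. \<Sum>j<p. (X i \<omega> j * Y i \<omega>)\<^sup>2)\<bar>) \<le>
    2 * real n * (2 * signal_level p \<beta> + real p * (signal_level p \<beta> + \<sigma>2))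
      + real n * (real n - 1) * signal_level p \<beta>"
proof -
  let ?w = "2 * signal_level p \<beta> + real p * (signal_level p \<beta> + \<sigma>2)"
  define Q where "Q \<omega> = (\<Sum>j<p. (\<Sum>i<n. X i \<omega> j * Y i \<omega>)\<^sup>2)" for \<omega>
  define V where "V \<omega> = (\<Sum>i<n. \<Sum>j<p. (X i \<omega> j * Y i \<omega>)\<^sup>2)" for \<omega>
  have w_mom: "finite_moments (\<lambda>\<omega>. X i \<omega> j * Y i \<omega>)" if "i < n" "j < p" for i j
    by (intro finite_moments_mult model_finite_moments that)
  have QV_mom: "finite_moments Q" "finite_moments V"
    unfolding Q_def[abs_def] V_def[abs_def] by (intro finite_moments_intros w_mom; simp)+
  have EV: "expectation V = real n * ?w"
    unfolding V_def[abs_def]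
    by (subst Bochner_Integration.integral_sum)
      (auto simp: expectation_W_square_norm intro!: finite_momentsD(3) finite_moments_intros w_mom)
  have EQ: "expectation Q = real n * ?w + real n * (real n - 1) * signal_level p \<beta>"
  proof -
    have coord: "expectation (\<lambda>\<omega>. (\<Sum>i<n. X i \<omega> j * Y i \<omega>)\<^sup>2) =
        (\<Sum>i<n. expectation (\<lambda>\<omega>. (X i \<omega> j * Y i \<omega>)\<^sup>2)) + real n * (real n - 1) * (\<beta> j)\<^sup>2" if j: "j < p" for j
    proof (rule expectation_square_sum_indep)
      show "indep_vars (\<lambda>_. borel) (\<lambda>i \<omega>. X i \<omega> j * Y i \<omega>) {..<n}"
        using indep_vars_compose2[OF independent, of "\<lambda>_ z. fst z j * snd z" "\<lambda>_. borel"] j by simp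
    qed (use w_mom expectation_covariate_response j in auto)
    have "expectation Q = (\<Sum>j<p. expectation (\<lambda>\<omega>. (\<Sum>i<n. X i \<omega> j * Y i \<omega>)\<^sup>2))"
      unfolding Q_def[abs_def]
      by (rule Bochner_Integration.integral_sum) (auto intro!: finite_momentsD(3) finite_moments_intros w_mom)
    also have "\<dots> = (\<Sum>j<p. \<Sum>i<n. expectation (\<lambda>\<omega>. (X i \<omega> j * Y i \<omega>)\<^sup>2))
        + real n * (real n - 1) * signal_level p \<beta>"
      by (simp add: coord sum.distrib signal_level_def sum_distrib_left)
    also have "(\<Sum>j<p. \<Sum>i<n. expectation (\<lambda>\<omega>. (X i \<omega> j * Y i \<omega>)\<^sup>2)) =
        (\<Sum>i<n. expectation (\<lambda>\<omega>. \<Sum>j<p. (X i \<omega> j * Y i \<omega>)\<^sup>2))"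
      by (subst sum.swap, intro sum.cong refl Bochner_Integration.integral_sum[symmetric])
        (auto intro!: finite_momentsD(3) finite_moments_intros w_mom)
    also have "\<dots> = real n * ?w" by (simp add: expectation_W_square_norm)
    finally show ?thesis .
  qed
  have "0 \<le> Q \<omega>" "0 \<le> V \<omega>" for \<omega>
    by (auto simp: Q_def V_def intro!: sum_nonneg)
  then have "expectation (\<lambda>\<omega>. \<bar>Q \<omega> - V \<omega>\<bar>) \<le> expectation (\<lambda>\<omega>. Q \<omega> + V \<omega>)"
    using QV_mom by (intro integral_mono integrable_abs finite_momentsD(3) finite_moments_intros) (auto simp: abs_le_iff add.commute)
  also have "\<dots> = 2 * real n * ?w + real n * (real n - 1) * signal_level p \<beta>"
    using QV_mom[THEN finite_momentsD(3)] by (simp add: EV EQ)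
  finally show ?thesis by (simp add: Q_def V_def)
qed

text \<open>
  The average is compared with its mean \<open>2 \<tau>\<^sup>2\<close>, and \<open>\<bar>t\<bar> \<le> (1 + t\<^sup>2)/2\<close> turns the variance bound into
  a bound on the mean deviation.
\<close>

lemma expectation_excess_average:
  assumes n: "1 \<le> n"
  shows "expectation (\<lambda>\<omega>. \<bar>(\<Sum>i<n. norm_excess p (X i \<omega>) * (Y i \<omega>)\<^sup>2) / real n\<bar>) \<le>
    2 * signal_level p \<beta> + 1 / 2 + (real p + 1) / real n * (6 + 3360 * (signal_level p \<beta> + \<sigma>2) ^ 4)"
proof -
  define \<mu> where "\<mu> = 2 * signal_level p \<beta>"
  define D where "D i \<omega> = norm_excess p (X i \<omega>) * (Y i \<omega>)\<^sup>2" for i \<omega>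
  define A where "A \<omega> = (\<Sum>i<n. D i \<omega>) / real n" for \<omega>
  define K where "K = (real p + 1) * (12 + 6720 * (signal_level p \<beta> + \<sigma>2) ^ 4)"
  have \<mu>: "0 \<le> \<mu>" by (simp add: \<mu>_def signal_level_def sum_nonneg)
  have D_mom: "finite_moments (D i)" if "i < n" for i
    unfolding D_def[abs_def] by (intro finite_moments_intros model_finite_moments that)
  have A_mom: "finite_moments A"
    unfolding A_def[abs_def] divide_inverse by (intro finite_moments_intros D_mom) auto
  have ED: "expectation (D i) = \<mu>" if "i < n" for i
    unfolding D_def[abs_def] \<mu>_def by (rule mean_excess_response[OF that])
  have var: "expectation (\<lambda>\<omega>. (D i \<omega> - \<mu>)\<^sup>2) \<le> K" if i: "i < n" for i
  proof -
    have "(\<lambda>\<omega>. (D i \<omega> - \<mu>)\<^sup>2) = (\<lambda>\<omega>. (D i \<omega>)\<^sup>2 - 2 * \<mu> * D i \<omega> + \<mu>\<^sup>2)"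
      by (simp add: fun_eq_iff power2_diff)
    then have "expectation (\<lambda>\<omega>. (D i \<omega> - \<mu>)\<^sup>2) = expectation (\<lambda>\<omega>. (D i \<omega>)\<^sup>2) - \<mu>\<^sup>2"
      using finite_momentsD(2)[OF D_mom[OF i], of 2] finite_momentsD(3)[OF D_mom[OF i]]
      by (simp add: ED i prob_space power2_eq_square)
    also have "\<dots> \<le> K"
      using second_moment_excess_response[OF i] zero_le_power2[of \<mu>]
      unfolding K_def D_def by linarith
    finally show ?thesis .
  qed
  have "expectation (\<lambda>\<omega>. (A \<omega> - \<mu>)\<^sup>2) = expectation (\<lambda>\<omega>. (\<Sum>i<n. D i \<omega> - \<mu>)\<^sup>2 / (real n)\<^sup>2)"
  proof -
    have "(A \<omega> - \<mu>)\<^sup>2 = (\<Sum>i<n. D i \<omega> - \<mu>)\<^sup>2 / (real n)\<^sup>2" for \<omega>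
      using n by (simp add: A_def sum_subtractf power_divide[symmetric] diff_divide_distrib)
    then show ?thesis by simp
  qed
  also have "\<dots> = (\<Sum>i<n. expectation (\<lambda>\<omega>. (D i \<omega> - \<mu>)\<^sup>2)) / (real n)\<^sup>2"
  proof -
    have "expectation (\<lambda>\<omega>. (\<Sum>i<n. D i \<omega> - \<mu>)\<^sup>2) =
        (\<Sum>i<n. expectation (\<lambda>\<omega>. (D i \<omega> - \<mu>)\<^sup>2)) + real n * (real n - 1) * 0\<^sup>2"
    proof (rule expectation_square_sum_indep)
      show "indep_vars (\<lambda>_. borel) (\<lambda>i \<omega>. D i \<omega> - \<mu>) {..<n}"
      proof -
        have "(\<lambda>z. norm_excess p (fst z) * (snd z)\<^sup>2 - \<mu>) \<in> borel_measurable (vec_borel p \<Otimes>\<^sub>M borel)"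
          using measurable_compose[OF measurable_fst norm_excess_measurable, of borel] by measurable
        from indep_vars_compose2[OF independent this] show ?thesis by (simp add: D_def)
      qed
      show "expectation (\<lambda>\<omega>. D i \<omega> - \<mu>) = 0" if "i < n" for i
        using ED[OF that] finite_momentsD(3)[OF D_mom[OF that]] by (simp add: prob_space)
    qed (intro finite_moments_intros D_mom)
    then show ?thesis by simp
  qed
  also have "\<dots> \<le> (\<Sum>i<n. K) / (real n)\<^sup>2"
    by (intro divide_right_mono sum_mono var) auto
  also have "\<dots> = K / real n" using n by (simp add: power2_eq_square)
  finally have A_var: "expectation (\<lambda>\<omega>. (A \<omega> - \<mu>)\<^sup>2) \<le> K / real n" .
  have bound: "\<bar>a\<bar> \<le> \<mu> + 1 / 2 + (a - \<mu>)\<^sup>2 / 2" for a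
  proof -
    have "\<bar>a - \<mu>\<bar> * 2 \<le> 1 + (a - \<mu>)\<^sup>2"
      using sum_squares_bound[of "\<bar>a - \<mu>\<bar>" 1] by simp
    moreover have "\<bar>a\<bar> \<le> \<bar>a - \<mu>\<bar> + \<mu>" using \<mu> by linarith
    ultimately show ?thesis by argo
  qed
  have sq_int: "integrable M (\<lambda>\<omega>. (A \<omega> - \<mu>)\<^sup>2)"
    by (intro finite_momentsD(3) finite_moments_intros A_mom)
  have "expectation (\<lambda>\<omega>. \<bar>A \<omega>\<bar>) \<le> expectation (\<lambda>\<omega>. \<mu> + 1 / 2 + (A \<omega> - \<mu>)\<^sup>2 / 2)"
    using sq_int by (intro integral_mono integrable_abs finite_momentsD(3)[OF A_mom] bound) simp
  also have "\<dots> = \<mu> + 1 / 2 + expectation (\<lambda>\<omega>. (A \<omega> - \<mu>)\<^sup>2) / 2"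
    using sq_int by (simp add: prob_space)
  also have "\<dots> \<le> \<mu> + 1 / 2 + K / real n / 2" using A_var by simp
  also have "K / real n / 2 = (real p + 1) / real n * (6 + 3360 * (signal_level p \<beta> + \<sigma>2) ^ 4)"
    by (simp add: K_def algebra_simps add_divide_distrib)
  finally show ?thesis by (simp add: A_def D_def \<mu>_def)
qed

text \<open>
  The constant depends on the bounds \<open>B\<close> and \<open>R\<close> only, so that this estimate is uniform along
  the sequence of models.
\<close>

lemma expected_estimator_difference:
  assumes n: "2 \<le> n" and B: "signal_level p \<beta> + \<sigma>2 \<le> B" and R: "real p / real n \<le> R"
  defines "d \<equiv> \<lambda>\<omega>. naive_estimator n p (\<lambda>i. X i \<omega>) (\<lambda>i. Y i \<omega>)
    - dicker_estimator n p (\<lambda>i. X i \<omega>) (\<lambda>i. Y i \<omega>)"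
  shows "integrable M d"
    and "expectation (\<lambda>\<omega>. \<bar>d \<omega>\<bar>) \<le>
      (8 * (R + 1) * B + 4 * B + 1 / 2 + (R + 1) * (6 + 3360 * B ^ 4)) / (real n + 1)"
proof -
  let ?t = "signal_level p \<beta>"
  let ?w = "2 * ?t + real p * (?t + \<sigma>2)"
  define U where "U \<omega> = (\<Sum>j<p. (\<Sum>i<n. X i \<omega> j * Y i \<omega>)\<^sup>2) - (\<Sum>i<n. \<Sum>j<p. (X i \<omega> j * Y i \<omega>)\<^sup>2)" for \<omega>
  define A where "A \<omega> = (\<Sum>i<n. norm_excess p (X i \<omega>) * (Y i \<omega>)\<^sup>2) / real n" for \<omega>
  define N where "N = real n"
  have N: "2 \<le> N" using n by (simp add: N_def)
  have "0 \<le> ?t" by (simp add: signal_level_def sum_nonneg)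
  with B noise_var_nonneg have t: "0 \<le> ?t" "?t \<le> B" "0 \<le> ?t + \<sigma>2" "0 \<le> B"
    by linarith+
  have p: "real p \<le> R * N" using R N by (simp add: N_def pos_divide_le_eq)
  have R0: "0 \<le> R" using R by (rule order_trans[rotated]) simp
  have U_mom: "finite_moments U"
    unfolding U_def[abs_def] by (intro finite_moments_intros model_finite_moments) auto
  have A_mom: "finite_moments A"
    unfolding A_def[abs_def] divide_inverse by (intro finite_moments_intros model_finite_moments) auto
  have d_eq: "d \<omega> = (2 / (N * (N - 1)) * U \<omega> - A \<omega>) / (N + 1)" for \<omega>
    unfolding d_def estimator_difference[OF n] U_def A_def N_def by simp
  have "finite_moments d"
    unfolding d_eq[abs_def] divide_inverse by (intro finite_moments_intros U_mom A_mom)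
  then show "integrable M d" by (rule finite_momentsD)
  have int: "integrable M (\<lambda>\<omega>. \<bar>U \<omega>\<bar>)" "integrable M (\<lambda>\<omega>. \<bar>A \<omega>\<bar>)"
    using finite_momentsD(3)[OF U_mom] finite_momentsD(3)[OF A_mom] by auto
  have "expectation (\<lambda>\<omega>. \<bar>d \<omega>\<bar>) \<le> expectation (\<lambda>\<omega>. (2 / (N * (N - 1)) * \<bar>U \<omega>\<bar> + \<bar>A \<omega>\<bar>) / (N + 1))"
  proof (rule integral_mono)
    show "integrable M (\<lambda>\<omega>. \<bar>d \<omega>\<bar>)" using \<open>integrable M d\<close> by simp
    show "integrable M (\<lambda>\<omega>. (2 / (N * (N - 1)) * \<bar>U \<omega>\<bar> + \<bar>A \<omega>\<bar>) / (N + 1))" using int by simp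
    show "\<bar>d \<omega>\<bar> \<le> (2 / (N * (N - 1)) * \<bar>U \<omega>\<bar> + \<bar>A \<omega>\<bar>) / (N + 1)" for \<omega>
    proof -
      have "\<bar>2 / (N * (N - 1)) * U \<omega> - A \<omega>\<bar> \<le> \<bar>2 / (N * (N - 1)) * U \<omega>\<bar> + \<bar>A \<omega>\<bar>"
        by (rule abs_triangle_ineq4)
      also have "\<bar>2 / (N * (N - 1)) * U \<omega>\<bar> = 2 / (N * (N - 1)) * \<bar>U \<omega>\<bar>"
        using N by (simp add: abs_mult)
      finally show ?thesis
        unfolding d_eq using N by (simp add: abs_divide divide_right_mono)
    qed
  qed
  also have "\<dots> = (2 / (N * (N - 1)) * expectation (\<lambda>\<omega>. \<bar>U \<omega>\<bar>) + expectation (\<lambda>\<omega>. \<bar>A \<omega>\<bar>)) / (N + 1)"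
    using int by simp
  also have "\<dots> \<le> (8 * (R + 1) * B + 4 * B + 1 / 2 + (R + 1) * (6 + 3360 * B ^ 4)) / (N + 1)"
  proof (rule divide_right_mono)
    have w: "?w \<le> (2 + R * N) * B"
    proof -
      have "?w \<le> 2 * B + (R * N) * B"
        using t B p by (intro add_mono mult_mono) auto
      then show ?thesis by (simp add: algebra_simps)
    qed
    have "expectation (\<lambda>\<omega>. \<bar>U \<omega>\<bar>) \<le> 2 * N * ?w + N * (N - 1) * ?t"
      using expectation_cross_terms by (simp add: U_def N_def)
    also have "\<dots> \<le> 2 * N * ((2 + R * N) * B) + N * (N - 1) * B"
      using w t N by (intro add_mono mult_left_mono) auto
    finally have "2 / (N * (N - 1)) * expectation (\<lambda>\<omega>. \<bar>U \<omega>\<bar>) \<le>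
        2 / (N * (N - 1)) * (2 * N * ((2 + R * N) * B) + N * (N - 1) * B)"
      using N by (intro mult_left_mono) auto
    also have "\<dots> = 4 * ((2 + R * N) / (N - 1)) * B + 2 * B"
      using N by (simp add: field_simps)
    also have "\<dots> \<le> 4 * (2 * (R + 1)) * B + 2 * B"
    proof -
      have "(2 + R * N) / (N - 1) \<le> 2 * (R + 1)"
      proof -
        \<comment> \<open>\<open>N = n \<ge> 2\<close> bounds both \<open>1 / (N - 1)\<close> by \<open>1\<close> and \<open>N / (N - 1)\<close> by \<open>2\<close>\<close>
        have "R * 2 \<le> R * N" using N R0 by (intro mult_left_mono)
        then have "2 + R * N \<le> 2 * (R + 1) * (N - 1)" using N by (simp add: algebra_simps)
        then show ?thesis using N by (simp add: pos_divide_le_eq)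
      qed
      then show ?thesis using t by (intro add_mono mult_right_mono mult_left_mono) auto
    qed
    finally have U: "2 / (N * (N - 1)) * expectation (\<lambda>\<omega>. \<bar>U \<omega>\<bar>) \<le> 8 * (R + 1) * B + 2 * B" by simp
    have "expectation (\<lambda>\<omega>. \<bar>A \<omega>\<bar>) \<le> 2 * ?t + 1 / 2 + (real p + 1) / N * (6 + 3360 * (?t + \<sigma>2) ^ 4)"
      using expectation_excess_average n by (simp add: A_def N_def)
    also have "\<dots> \<le> 2 * B + 1 / 2 + (R + 1) * (6 + 3360 * B ^ 4)"
    proof -
      have "(real p + 1) / N \<le> R + 1" using p N by (simp add: pos_divide_le_eq algebra_simps)
      moreover have "(?t + \<sigma>2) ^ 4 \<le> B ^ 4" using B t by (intro power_mono) auto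
      ultimately show ?thesis using t R0 N by (intro add_mono mult_mono) auto
    qed
    finally show "2 / (N * (N - 1)) * expectation (\<lambda>\<omega>. \<bar>U \<omega>\<bar>) + expectation (\<lambda>\<omega>. \<bar>A \<omega>\<bar>) \<le>
        8 * (R + 1) * B + 4 * B + 1 / 2 + (R + 1) * (6 + 3360 * B ^ 4)" using U by linarith
  qed (use N in auto)
  finally show "expectation (\<lambda>\<omega>. \<bar>d \<omega>\<bar>) \<le>
      (8 * (R + 1) * B + 4 * B + 1 / 2 + (R + 1) * (6 + 3360 * B ^ 4)) / (real n + 1)"
    by (simp add: N_def)
qed

end


section \<open>Convergence in probability\<close>

theorem lemma2p1:
  fixes M :: "nat \<Rightarrow> 'a measure"
    and p :: "nat \<Rightarrow> nat"
    and X :: "nat \<Rightarrow> nat \<Rightarrow> 'a \<Rightarrow> nat \<Rightarrow> real"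
    and Y \<epsilon> :: "nat \<Rightarrow> nat \<Rightarrow> 'a \<Rightarrow> real"
    and \<beta> :: "nat \<Rightarrow> nat \<Rightarrow> real"
    and \<sigma>2 :: "nat \<Rightarrow> real"
    and c :: real
  assumes model: "\<And>n. n \<ge> 1 \<Longrightarrow> linear_model (M n) n (p n) (X n) (Y n) (\<epsilon> n) (\<beta> n) (\<sigma>2 n)"
    and gaussian_covariates:
      "\<And>n i. i < n \<Longrightarrow> distr (M n) (vec_borel (p n)) (X n i) = std_normal_vec (p n)"
    and gaussian_noise: "\<And>n i. i < n \<Longrightarrow> distr (M n) borel (\<epsilon> n i) = normal_law 0 (\<sigma>2 n)"
    and bounded: "bounded (range (\<lambda>n. signal_level (p n) (\<beta> n) + \<sigma>2 n))"
    and p_infinity: "filterlim p at_top sequentially"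
    and p_ratio: "(\<lambda>n. real (p n) / real n) \<longlonglongrightarrow> c"
  shows "converges_in_probability M
           (\<lambda>n \<omega>. sqrt (real n) *
              (naive_estimator n (p n) (\<lambda>i. X n i \<omega>) (\<lambda>i. Y n i \<omega>) -
               dicker_estimator n (p n) (\<lambda>i. X n i \<omega>) (\<lambda>i. Y n i \<omega>))) 0"
proof -
  obtain B where B: "signal_level (p n) (\<beta> n) + \<sigma>2 n \<le> B" for n
  proof -
    obtain B where "\<forall>v \<in> range (\<lambda>n. signal_level (p n) (\<beta> n) + \<sigma>2 n). norm v \<le> B"
      using bounded by (auto simp: bounded_iff)
    then have "norm (signal_level (p n) (\<beta> n) + \<sigma>2 n) \<le> B" for n by blast
    then show ?thesis by (intro that[of B]) (simp add: abs_le_iff)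
  qed
  obtain R where R: "real (p n) / real n \<le> R" for n
  proof -
    have "Bseq (\<lambda>n. real (p n) / real n)"
      by (rule convergent_imp_Bseq) (use p_ratio in \<open>auto simp: convergent_def\<close>)
    then obtain R where "\<And>n. norm (real (p n) / real n) \<le> R" by (auto simp: Bseq_def)
    then show ?thesis by (intro that[of R]) simp
  qed
  define C where "C = 8 * (R + 1) * B + 4 * B + 1 / 2 + (R + 1) * (6 + 3360 * B ^ 4)"
  define d where "d n \<omega> = naive_estimator n (p n) (\<lambda>i. X n i \<omega>) (\<lambda>i. Y n i \<omega>)
      - dicker_estimator n (p n) (\<lambda>i. X n i \<omega>) (\<lambda>i. Y n i \<omega>)" for n \<omega>
  have tail: "measure (M n) {\<omega> \<in> space (M n). \<bar>sqrt (real n) * d n \<omega> - 0\<bar> > e} \<le>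
      sqrt (real n) * (C / (real n + 1)) / e" if n: "2 \<le> n" and e: "0 < e" for n e
  proof -
    interpret linear_model "M n" n "p n" "X n" "Y n" "\<epsilon> n" "\<beta> n" "\<sigma>2 n"
      using model n by simp
    interpret gaussian_linear_model "M n" n "p n" "X n" "Y n" "\<epsilon> n" "\<beta> n" "\<sigma>2 n"
      by unfold_locales (auto intro: gaussian_covariates gaussian_noise)
    have int: "integrable (M n) (d n)"
      unfolding d_def[abs_def] by (rule expected_estimator_difference(1)[OF n B R])
    have L1: "expectation (\<lambda>\<omega>. \<bar>d n \<omega>\<bar>) \<le> C / (real n + 1)"
      unfolding d_def C_def by (rule expected_estimator_difference(2)[OF n B R])
    let ?u = "\<lambda>\<omega>. sqrt (real n) * \<bar>d n \<omega>\<bar>"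
    have u_int: "integrable (M n) ?u" using int by simp
    have u_meas[measurable]: "?u \<in> borel_measurable (M n)" using u_int by auto
    have "prob {\<omega> \<in> space (M n). \<bar>sqrt (real n) * d n \<omega> - 0\<bar> > e} \<le> prob {\<omega> \<in> space (M n). ?u \<omega> \<ge> e}"
      by (rule finite_measure_mono) (auto simp: abs_mult)
    also have "\<dots> \<le> expectation ?u / e"
      by (rule integral_Markov_inequality_measure[OF u_int, of "{}"]) (use e in auto)
    also have "\<dots> \<le> sqrt (real n) * (C / (real n + 1)) / e"
      unfolding integral_mult_right_zero using L1 e by (intro divide_right_mono mult_left_mono) auto
    finally show ?thesis .
  qed
  have "(\<lambda>n. measure (M n) {\<omega> \<in> space (M n). \<bar>sqrt (real n) * d n \<omega> - 0\<bar> > e}) \<longlonglongrightarrow> 0"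
    if e: "0 < e" for e
  proof (rule tendsto_sandwich[where f = "\<lambda>_. 0"])
    show "\<forall>\<^sub>F n in sequentially. measure (M n) {\<omega> \<in> space (M n). \<bar>sqrt (real n) * d n \<omega> - 0\<bar> > e} \<le>
        sqrt (real n) * (C / (real n + 1)) / e"
      using eventually_ge_at_top[of 2] by eventually_elim (rule tail[OF _ e])
    show "(\<lambda>n. sqrt (real n) * (C / (real n + 1)) / e) \<longlonglongrightarrow> 0"
    proof -
      have "(\<lambda>n. sqrt (real n) / (real n + 1)) \<longlonglongrightarrow> 0" by real_asymp
      from tendsto_mult_right[OF this, of "C / e"] show ?thesis by (simp add: field_simps)
    qed
  qed (auto intro: measure_nonneg)
  then show ?thesis
    unfolding converges_in_probability_def d_def by blast
qed

end
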